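(* In the single-scaling setting of the context, assume that $\mathcal{M}_{m_0}$ is the optimal model. Let $m\in\{1,\dots,M\}\setminus\{m_0\}$, let conditions (A1)–(A3) of the context hold for the candidate models, and suppose that either (i) $\Theta_{m_0}$ is nested in $\Theta_m$, or (ii) $\mathbb{H}_{m,0}(\theta_m)\ne\mathbb{H}_{m_0,0}(\theta_{m_0,0})$ a.s. for any $\theta_m\in\Theta_m$. Then $$\lim_{n\to\infty}\mathbb{P}\big(\mathrm{QBIC}_n^{(m_0)}-\mathrm{QBIC}_n^{(m)}<0\big)=1,\qquad \lim_{n\to\infty}\mathbb{P}\big(\mathrm{BIC}_n^{(m_0)}-\mathrm{BIC}_n^{(m)}<0\big)=1 .$$
   Context: Setting. There are $M$ candidate models $\mathcal{M}_1,\dots,\mathcal{M}_M$. Model $\mathcal{M}_m$ has parameter space $\Theta_m\subset\mathbb{R}^{p_m}$ (a bounded convex domain), a quasi-log likelihood $\mathbb{H}_{m,n}(\theta_m)=\mathbb{H}_{m,n}(\mathbf{X}_n|\theta_m)$ which is a random function of the data $\mathbf{X}_n$, a.s. continuous on $\bar\Theta_m$, a prior density $\pi_{m,n}:\Theta_m\to(0,\infty)$, and a QMLE $\hat\theta_{m,n}$, any maximizer of $\mathbb{H}_{m,n}$ over $\bar\Theta_m$. Single scaling: there is one deterministic positive sequence $a_n\to0$ which is the convergence rate for all components in all models, so the rate matrix of $\mathcal{M}_m$ is $a_nI_{p_m}$. For each $m$ there is a random function $\mathbb{H}_{m,0}$ on $\Theta_m$ with $$a_n^2\mathbb{H}_{m,n}(\theta_m)\to\mathbb{H}_{m,0}(\theta_m)\quad\text{in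 probability as }n\to\infty,$$ and the optimal parameter $\theta_{m,0}\in\Theta_m$ (a constant) is the unique maximizer of $\mathbb{H}_{m,0}$ over $\Theta_m$. Standing assumption: $a_n^{-1}(\hat\theta_{m,n}-\theta_{m,0})$ converges in distribution to a non-trivial limit for each $m$. Optimal model: with $\mathfrak{M}=\mathrm{argmax}_{1\le m\le M}\mathbb{H}_{m,0}(\theta_{m,0})$, $\mathcal{M}_{m_0}$ is the optimal model if $\{m_0\}=\mathrm{argmin}_{m\in\mathfrak{M}}\dim(\Theta_m)$, where $\dim(\Theta_m)=p_m$. Nestedness: $\Theta_i\subset\mathbb{R}^{p_i}$ is nested in $\Theta_j\subset\mathbb{R}^{p_j}$ if $p_i<p_j$ and there exist $F\in\mathbb{R}^{p_j\times p_i}$ with $F'F=I_{p_i}$ and $c\in\mathbb{R}^{p_j}$ such that $\mathbb{H}_{i,n}(\theta_i)=\mathbb{H}_{j,n}(F\theta_i+c)$ for all $\theta_i\in\Theta_i$ (with $F\theta_i+c\in\Theta_j$). Criteria ($|A|=\det A$): $$\mathrm{QBIC}_n^{(m)}=-2\mathbb{H}_{m,n}(\hat\theta_{m,n})+\log\big|-\partial_{\theta_m}^2\mathbb{H}_{m,n}(\hat\theta_{m,n})\big|,\qquad \mathrm{BIC}_n^{(m)}=-2\mathbb{H}_{m,n}(\hat\theta_{m,n})+2p_m\log a_n^{-1}.$$ Conditions, for each model, dropping the model index $m$ (so $\theta_0=\theta_{m,0}$, $p=p_m$, etc.), with $\mathbb{U}_n=\{u\in\mathbb{R}^p:\theta_0+a_nu\in\Theta\}$,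 $\mathbb{Z}_n(u)=\exp\{\mathbb{H}_n(\theta_0+a_nu)-\mathbb{H}_n(\theta_0)\}$: (A1) $\mathbb{H}_n$ is of class $\mathcal{C}^3(\Theta)$; $a_n\partial_\theta\mathbb{H}_n(\theta_0)=O_p(1)$; $-a_n^2\partial_\theta^2\mathbb{H}_n(\theta_0)=\Gamma_0+o_p(1)$ with $\Gamma_0$ (possibly random) a.s. positive definite; and $\max_{i,j,k\le p}\sup_\theta|a_n^3\partial_{\theta^i}\partial_{\theta^j}\partial_{\theta^k}\mathbb{H}_n(\theta)|=o_p(1)$, where $\theta^i$ is the $i$th coordinate of $\theta$. (A2) $\pi_n(\theta_0)>0$ for all $n$, $\sup_n\sup_\theta\pi_n(\theta)<\infty$, and $\sup_{|u|<M}|\pi_n(\theta_0+a_nu)-\pi_n(\theta_0)|\to0$ for each $M>0$. (A3) For any $\epsilon>0$ there exist $M>0$ and $N$ such that $\sup_{n\ge N}\mathbb{P}\big(\int_{\mathbb{U}_n\cap\{|u|\ge M\}}\mathbb{Z}_n(u)du>\epsilon\big)<\epsilon$. *)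

theory Defs
  imports "HOL-Probability.Probability" "Jordan_Normal_Form.Determinant"
begin

text \<open>The dimension varies from model to model, so R^p is the library's \<open>Euclidean_space p\<close>: functions
  \<open>nat \<Rightarrow> real\<close> vanishing from index \<open>p\<close> on, with the usual topology.  Coordinates are numbered from
  \<open>0\<close>.  \<open>L2_set x {..<p}\<close> is the Euclidean norm of \<open>x\<close>.\<close>

definition borelE :: "nat \<Rightarrow> (nat \<Rightarrow> real) measure" where
  "borelE p = restrict_space borel (topspace (Euclidean_space p))"

text \<open>Points of the library's product measure are \<open>undefined\<close> outside the index set, whereas points of
  \<open>Euclidean_space p\<close> are \<open>0\<close> there; hence the change of representation.\<close>

definition lborelE :: "nat \<Rightarrow> (nat \<Rightarrow> real) measure" where
  "lborelE p = distr (PiM {..<p} (\<lambda>_. lborel)) (borelE p) (\<lambda>x i. if i < p then x i else 0)"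

lemma measurable_embed_borelE:
  "(\<lambda>x i. if i < p then x i else 0) \<in> measurable (PiM {..<p} (\<lambda>_. lborel)) (borelE p)"
  unfolding borelE_def
proof (rule measurable_restrict_space2)
  show "(\<lambda>x i. if i < p then x i else 0)
      \<in> space (PiM {..<p} (\<lambda>_. lborel)) \<rightarrow> topspace (Euclidean_space p)"
    by (auto simp: topspace_Euclidean_space)
  show "(\<lambda>x i. if i < p then x i else (0::real))
      \<in> borel_measurable (PiM {..<p} (\<lambda>_. lborel))"
  proof (rule measurable_coordinatewise_then_product)
    fix i
    show "(\<lambda>x. if i < p then x i else (0::real)) \<in> borel_measurable (PiM {..<p} (\<lambda>_. lborel))"
    proof (cases "i < p")
      case True
      then have "(\<lambda>x. x i) \<in> measurable (PiM {..<p} (\<lambda>_. lborel)) (lborel :: real measure)"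
        by (intro measurable_component_singleton) auto
      then show ?thesis using True by simp
    qed simp
  qed
qed

definition bounded_convex_domain :: "nat \<Rightarrow> (nat \<Rightarrow> real) set \<Rightarrow> bool" where
  "bounded_convex_domain p S \<longleftrightarrow>
     S \<noteq> {} \<and> openin (Euclidean_space p) S \<and>
     (\<exists>B. \<forall>x\<in>S. L2_set x {..<p} \<le> B) \<and>
     (\<forall>x\<in>S. \<forall>y\<in>S. \<forall>t\<in>{0..1}. (\<lambda>i. (1 - t) * x i + t * y i) \<in> S)"

definition pd :: "nat \<Rightarrow> ((nat \<Rightarrow> real) \<Rightarrow> real) \<Rightarrow> (nat \<Rightarrow> real) \<Rightarrow> real" where
  "pd i f x = deriv (\<lambda>t. f (x(i := t))) (x i)"

primrec class_C :: "nat \<Rightarrow> nat \<Rightarrow> (nat \<Rightarrow> real) set \<Rightarrow> ((nat \<Rightarrow> real) \<Rightarrow> real) \<Rightarrow> bool" where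
  "class_C p 0 S f \<longleftrightarrow> continuous_map (subtopology (Euclidean_space p) S) euclideanreal f"
| "class_C p (Suc k) S f \<longleftrightarrow>
     continuous_map (subtopology (Euclidean_space p) S) euclideanreal f \<and>
     (\<forall>i<p. (\<forall>x\<in>S. (\<lambda>t. f (x(i := t))) field_differentiable at (x i)) \<and> class_C p k S (pd i f))"

definition hessian :: "nat \<Rightarrow> ((nat \<Rightarrow> real) \<Rightarrow> real) \<Rightarrow> (nat \<Rightarrow> real) \<Rightarrow> real mat" where
  "hessian p f x = mat p p (\<lambda>(i, j). pd i (pd j f) x)"

definition pos_definite :: "nat \<Rightarrow> real mat \<Rightarrow> bool" where
  "pos_definite p A \<longleftrightarrow> A \<in> carrier_mat p p \<and> transpose_mat A = A \<and>
     (\<forall>v \<in> carrier_vec p. v \<noteq> 0\<^sub>v p \<longrightarrow> scalar_prod v (A *\<^sub>v v) > 0)"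

definition affine_emb :: "real mat \<Rightarrow> (nat \<Rightarrow> real) \<Rightarrow> (nat \<Rightarrow> real) \<Rightarrow> nat \<Rightarrow> real" where
  "affine_emb F c x = (\<lambda>r. if r < dim_row F
      then (\<Sum>s<dim_col F. index_mat F (r, s) * x s) + c r else 0)"

definition shift :: "(nat \<Rightarrow> real) \<Rightarrow> real \<Rightarrow> (nat \<Rightarrow> real) \<Rightarrow> nat \<Rightarrow> real" where
  "shift \<theta> a u = (\<lambda>i. \<theta> i + a * u i)"

text \<open>Events such as "a supremum exceeds \<open>\<epsilon>\<close>", or those involving a derivative at a point where the
  likelihood is not smooth, need not be measurable on exceptional sets, and \<open>measure\<close> is \<open>0\<close> on
  non-measurable sets.  Hence upper bounds on probabilities are stated with outer probability
  (\<open>outer_measure_of\<close>) and convergence of a probability to \<open>1\<close> with inner probability.  Both are the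
  ordinary probability on measurable events.\<close>

definition inner_prob :: "'w measure \<Rightarrow> 'w set \<Rightarrow> real" where
  "inner_prob P S = (SUP A \<in> {A \<in> sets P. A \<subseteq> S}. measure P A)"

lemma inner_prob_eq:
  assumes "prob_space P" "S \<in> sets P"
  shows "inner_prob P S = measure P S"
proof -
  interpret prob_space P by fact
  show ?thesis unfolding inner_prob_def
    by (rule cSup_eq_maximum) (use assms(2) in \<open>auto intro!: finite_measure_mono\<close>)
qed

text \<open>Both symbols take (norms of) random elements with values in \<open>[0,\<infinity>]\<close>, since suprema may be
  infinite.\<close>

definition small_op1 :: "'w measure \<Rightarrow> (nat \<Rightarrow> 'w \<Rightarrow> ennreal) \<Rightarrow> bool" where
  "small_op1 P X \<longleftrightarrow> (\<forall>\<epsilon>>0.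
     (\<lambda>n. outer_measure_of P {\<omega> \<in> space P. X n \<omega> > ennreal \<epsilon>}) \<longlonglongrightarrow> 0)"

definition big_Op1 :: "'w measure \<Rightarrow> (nat \<Rightarrow> 'w \<Rightarrow> ennreal) \<Rightarrow> bool" where
  "big_Op1 P X \<longleftrightarrow> (\<forall>\<epsilon>>0. \<exists>K::real. \<exists>N. \<forall>n\<ge>N.
     outer_measure_of P {\<omega> \<in> space P. X n \<omega> > ennreal K} < ennreal \<epsilon>)"

definition converges_in_distr ::
    "'w measure \<Rightarrow> nat \<Rightarrow> (nat \<Rightarrow> 'w \<Rightarrow> nat \<Rightarrow> real) \<Rightarrow> (nat \<Rightarrow> real) measure \<Rightarrow> bool" where
  "converges_in_distr P p X L \<longleftrightarrow>
     (\<forall>f. continuous_map (Euclidean_space p) euclideanreal f \<and>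
          (\<exists>B. \<forall>x \<in> topspace (Euclidean_space p). \<bar>f x\<bar> \<le> B) \<longrightarrow>
          (\<lambda>n. \<integral>\<omega>. f (X n \<omega>) \<partial>P) \<longlonglongrightarrow> (\<integral>x. f x \<partial>L))"

text \<open>The data enter only through the point \<open>\<omega>\<close> of the probability space: \<open>qlik A n \<omega> \<theta>\<close> is the
  quasi-log likelihood at \<open>\<theta>\<close> given \<open>X\<^sub>n(\<omega>)\<close>.  \<open>qlim A \<omega>\<close> is its (random) scaled limit, \<open>opt A\<close> the optimal
  parameter and \<open>qmle A n \<omega>\<close> the estimator.\<close>

record 'w model =
  pdim :: nat
  pspace :: "(nat \<Rightarrow> real) set"
  qlik :: "nat \<Rightarrow> 'w \<Rightarrow> (nat \<Rightarrow> real) \<Rightarrow> real"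
  prior :: "nat \<Rightarrow> (nat \<Rightarrow> real) \<Rightarrow> real"
  qmle :: "nat \<Rightarrow> 'w \<Rightarrow> nat \<Rightarrow> real"
  qlim :: "'w \<Rightarrow> (nat \<Rightarrow> real) \<Rightarrow> real"
  opt :: "nat \<Rightarrow> real"

definition pclosure :: "'w model \<Rightarrow> (nat \<Rightarrow> real) set" where
  "pclosure A = Euclidean_space (pdim A) closure_of pspace A"

definition valid_qlik :: "'w measure \<Rightarrow> 'w model \<Rightarrow> bool" where
  "valid_qlik P A \<longleftrightarrow>
     (\<forall>n. (\<forall>\<theta> \<in> pclosure A. (\<lambda>\<omega>. qlik A n \<omega> \<theta>) \<in> borel_measurable P) \<and>
          (AE \<omega> in P. continuous_map (subtopology (Euclidean_space (pdim A)) (pclosure A))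
                        euclideanreal (qlik A n \<omega>)))"

definition valid_prior :: "'w model \<Rightarrow> bool" where
  "valid_prior A \<longleftrightarrow>
     (\<forall>n. prior A n \<in> borel_measurable (restrict_space borel (pspace A)) \<and>
          (\<forall>\<theta> \<in> pspace A. prior A n \<theta> > 0) \<and>
          (\<integral>\<^sup>+\<theta>. ennreal (prior A n \<theta>) * indicator (pspace A) \<theta> \<partial>lborelE (pdim A)) = 1)"

definition valid_qmle :: "'w measure \<Rightarrow> 'w model \<Rightarrow> bool" where
  "valid_qmle P A \<longleftrightarrow>
     (\<forall>n. qmle A n \<in> measurable P (borelE (pdim A)) \<and>
          (AE \<omega> in P. is_arg_max (qlik A n \<omega>) (\<lambda>\<theta>. \<theta> \<in> pclosure A) (qmle A n \<omega>)))"

definition valid_limit :: "'w measure \<Rightarrow> (nat \<Rightarrow> real) \<Rightarrow> 'w model \<Rightarrow> bool" where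
  "valid_limit P a A \<longleftrightarrow>
     (\<forall>\<theta> \<in> pspace A. (\<lambda>\<omega>. qlim A \<omega> \<theta>) \<in> borel_measurable P \<and>
        small_op1 P (\<lambda>n \<omega>. ennreal \<bar>(a n)\<^sup>2 * qlik A n \<omega> \<theta> - qlim A \<omega> \<theta>\<bar>)) \<and>
     opt A \<in> pspace A \<and>
     (AE \<omega> in P. {\<theta>. is_arg_max (qlim A \<omega>) (\<lambda>\<theta>. \<theta> \<in> pspace A) \<theta>} = {opt A})"

text \<open>"Non-trivial" limit law: not concentrated at a single point.\<close>

definition qmle_rate :: "'w measure \<Rightarrow> (nat \<Rightarrow> real) \<Rightarrow> 'w model \<Rightarrow> bool" where
  "qmle_rate P a A \<longleftrightarrow>
     (\<exists>L. prob_space L \<and> sets L = sets (borelE (pdim A)) \<and>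
        converges_in_distr P (pdim A) (\<lambda>n \<omega> i. (qmle A n \<omega> i - opt A i) / a n) L \<and>
        \<not> (\<exists>x. AE y in L. y = x))"

definition candidate_model :: "'w measure \<Rightarrow> (nat \<Rightarrow> real) \<Rightarrow> 'w model \<Rightarrow> bool" where
  "candidate_model P a A \<longleftrightarrow>
     bounded_convex_domain (pdim A) (pspace A) \<and> valid_qlik P A \<and> valid_prior A \<and>
     valid_qmle P A \<and> valid_limit P a A \<and> qmle_rate P a A"

text \<open>The set of maximal models may depend on \<open>\<omega>\<close>, as the limits \<open>qlim\<close> are random; the defining
  property is required almost surely.\<close>

definition optimal_model :: "'w measure \<Rightarrow> nat \<Rightarrow> (nat \<Rightarrow> 'w model) \<Rightarrow> nat \<Rightarrow> bool" where
  "optimal_model P M \<M> m0 \<longleftrightarrow>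
     (AE \<omega> in P.
        let best = {k. is_arg_max (\<lambda>k. qlim (\<M> k) \<omega> (opt (\<M> k))) (\<lambda>k. k \<in> {1..M}) k}
        in {k. is_arg_min (\<lambda>k. pdim (\<M> k)) (\<lambda>k. k \<in> best) k} = {m0})"

definition nested :: "'w measure \<Rightarrow> 'w model \<Rightarrow> 'w model \<Rightarrow> bool" where
  "nested P A B \<longleftrightarrow> pdim A < pdim B \<and>
     (\<exists>F \<in> carrier_mat (pdim B) (pdim A). \<exists>c \<in> topspace (Euclidean_space (pdim B)).
        transpose_mat F * F = 1\<^sub>m (pdim A) \<and>
        (\<forall>\<theta> \<in> pspace A. affine_emb F c \<theta> \<in> pspace B) \<and>
        (\<forall>n. AE \<omega> in P. \<forall>\<theta> \<in> pspace A. qlik A n \<omega> \<theta> = qlik B n \<omega> (affine_emb F c \<theta>)))"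

definition cond_A1 :: "'w measure \<Rightarrow> (nat \<Rightarrow> real) \<Rightarrow> 'w model \<Rightarrow> bool" where
  "cond_A1 P a A \<longleftrightarrow> (let p = pdim A; \<Theta> = pspace A; \<theta>0 = opt A; H = qlik A in
     (\<forall>n. AE \<omega> in P. class_C p 3 \<Theta> (H n \<omega>)) \<and>
     big_Op1 P (\<lambda>n \<omega>. ennreal (L2_set (\<lambda>i. a n * pd i (H n \<omega>) \<theta>0) {..<p})) \<and>
     (\<exists>\<Gamma>0. (\<forall>i<p. \<forall>j<p. (\<lambda>\<omega>. index_mat (\<Gamma>0 \<omega>) (i, j)) \<in> borel_measurable P) \<and>
           (AE \<omega> in P. pos_definite p (\<Gamma>0 \<omega>)) \<and>
           (\<forall>i<p. \<forall>j<p. small_op1 P (\<lambda>n \<omega>.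
              ennreal \<bar>- (a n)\<^sup>2 * index_mat (hessian p (H n \<omega>) \<theta>0) (i, j)
                       - index_mat (\<Gamma>0 \<omega>) (i, j)\<bar>))) \<and>
     small_op1 P (\<lambda>n \<omega>. SUP (i, j, k) \<in> {..<p} \<times> {..<p} \<times> {..<p}. SUP \<theta> \<in> \<Theta>.
        ennreal \<bar>a n ^ 3 * pd i (pd j (pd k (H n \<omega>))) \<theta>\<bar>))"

definition cond_A2 :: "(nat \<Rightarrow> real) \<Rightarrow> 'w model \<Rightarrow> bool" where
  "cond_A2 a A \<longleftrightarrow> (let p = pdim A; \<Theta> = pspace A; \<theta>0 = opt A; \<pi> = prior A in
     (\<forall>n. \<pi> n \<theta>0 > 0) \<and>
     (\<exists>B. \<forall>n. \<forall>\<theta> \<in> \<Theta>. \<pi> n \<theta> \<le> B) \<and>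
     (\<forall>K>0. (\<lambda>n. SUP u \<in> {u \<in> topspace (Euclidean_space p).
                             L2_set u {..<p} < K \<and> shift \<theta>0 (a n) u \<in> \<Theta>}.
                \<bar>\<pi> n (shift \<theta>0 (a n) u) - \<pi> n \<theta>0\<bar>) \<longlonglongrightarrow> 0))"

definition U_set :: "(nat \<Rightarrow> real) \<Rightarrow> 'w model \<Rightarrow> nat \<Rightarrow> (nat \<Rightarrow> real) set" where
  "U_set a A n = {u \<in> topspace (Euclidean_space (pdim A)). shift (opt A) (a n) u \<in> pspace A}"

definition Z_field :: "(nat \<Rightarrow> real) \<Rightarrow> 'w model \<Rightarrow> nat \<Rightarrow> 'w \<Rightarrow> (nat \<Rightarrow> real) \<Rightarrow> real" where
  "Z_field a A n \<omega> u = exp (qlik A n \<omega> (shift (opt A) (a n) u) - qlik A n \<omega> (opt A))"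

definition cond_A3 :: "'w measure \<Rightarrow> (nat \<Rightarrow> real) \<Rightarrow> 'w model \<Rightarrow> bool" where
  "cond_A3 P a A \<longleftrightarrow> (\<forall>\<epsilon>>0. \<exists>K>0. \<exists>N.
     (SUP n \<in> {N..}. outer_measure_of P {\<omega> \<in> space P.
        (\<integral>\<^sup>+u. ennreal (Z_field a A n \<omega> u) *
               indicator (U_set a A n \<inter> {u. L2_set u {..<pdim A} \<ge> K}) u \<partial>lborelE (pdim A))
        > ennreal \<epsilon>}) < ennreal \<epsilon>)"

definition QBIC :: "'w model \<Rightarrow> nat \<Rightarrow> 'w \<Rightarrow> real" where
  "QBIC A n \<omega> = - 2 * qlik A n \<omega> (qmle A n \<omega>)
     + ln (det (- hessian (pdim A) (qlik A n \<omega>) (qmle A n \<omega>)))"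

definition BIC :: "(nat \<Rightarrow> real) \<Rightarrow> 'w model \<Rightarrow> nat \<Rightarrow> 'w \<Rightarrow> real" where
  "BIC a A n \<omega> = - 2 * qlik A n \<omega> (qmle A n \<omega>) + 2 * real (pdim A) * ln (inverse (a n))"

end

theory Submission
  imports Defs
begin

text \<open>Write \<open>H\<close> for the quasi-log likelihood, \<open>\<theta>\<^sub>0\<close> for the optimal parameter and \<open>q\<close> for the QMLE.
  Since \<open>q - \<theta>\<^sub>0\<close> is of order \<open>a\<^sub>n\<close>, the bound on the third derivatives gives \<open>H q - H \<theta>\<^sub>0 = O\<^sub>p(1)\<close> and
  makes the rescaled Hessian at \<open>q\<close> converge to \<open>\<Gamma>\<^sub>0\<close>, whose determinant is positive.  Hence both QBIC and BIC
  equal \<open>- 2 H \<theta>\<^sub>0 + 2 p ln a\<^sub>n\<inverse> + O\<^sub>p(1)\<close>.  If the optimal model is nested in the other one, uniqueness of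
  the maximizer identifies the two optimal parameters, the likelihoods there cancel, and the larger dimension of
  the other model decides.  Otherwise the difference of the likelihoods at the optimal parameters is of
  the exact order \<open>a\<^sub>n\<inverse>\<^sup>2\<close> and dominates the logarithmic penalty.\<close>

section \<open>Bounds from partial derivatives\<close>

text \<open>A basic open set of the product topology gives a radius for each coordinate, and points
  of the space agree from index \<open>p\<close> on, so the minimum of the first \<open>p\<close>
  radii serves. This later places a box with sides of order \<open>a n\<close> around the optimal
  parameter inside the parameter space.\<close>

lemma openin_Euclidean_space_box:
  assumes "openin (Euclidean_space p) S" and "x \<in> S"
  shows "\<exists>d>0. \<forall>y\<in>topspace (Euclidean_space p). (\<forall>i<p. \<bar>y i - x i\<bar> < d) \<longrightarrow> y \<in> S"
proof -
  obtain T where T: "openin (powertop_real UNIV) T" and S: "S = T \<inter> topspace (Euclidean_space p)"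
    using assms(1) unfolding topspace_Euclidean_space unfolding Euclidean_space_def openin_subtopology
    by blast
  have "x \<in> T" using assms(2) S by simp
  with T obtain U where "\<And>i. open (U i)" "x \<in> Pi\<^sub>E UNIV U" and U: "Pi\<^sub>E UNIV U \<subseteq> T"
    unfolding openin_product_topology_alt by fastforce
  have "\<exists>d>0. \<forall>t. \<bar>t - x i\<bar> < d \<longrightarrow> t \<in> U i" for i
    using \<open>open (U i)\<close> \<open>x \<in> Pi\<^sub>E UNIV U\<close> unfolding open_dist by (auto simp: dist_real_def PiE_def)
  then obtain d where d: "\<And>i. d i > 0" "\<And>i t. \<bar>t - x i\<bar> < d i \<Longrightarrow> t \<in> U i"
    by metis
  \<comment> \<open>The \<open>1\<close> keeps the set nonempty when \<open>p = 0\<close>.\<close>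
  define e where "e = Min (insert 1 (d ` {..<p}))"
  show ?thesis
  proof (intro exI conjI ballI impI)
    show "e > 0" unfolding e_def using d(1) by (subst Min_gr_iff) auto
    fix y assume y: "y \<in> topspace (Euclidean_space p)" "\<forall>i<p. \<bar>y i - x i\<bar> < e"
    have "y i \<in> U i" for i
    proof (cases "i < p")
      case True
      then have "e \<le> d i" unfolding e_def by (intro Min_le) auto
      with y(2) True show ?thesis by (intro d(2)) (meson order_less_le_trans)
    next
      case False
      with y(1) assms(2) S have "y i = x i" by (simp add: topspace_Euclidean_space)
      then show ?thesis using d(1)[of i] by (intro d(2)) simp
    qed
    with U y(1) S show "y \<in> S" by auto
  qed
qed

text \<open>Changing one coordinate at a time needs only the one-dimensional mean value theorem, and hence no
  total derivative.\<close>

lemma pd_mean_value_bound: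
  fixes x y :: "nat \<Rightarrow> real"
  assumes eq: "\<And>i. i \<ge> p \<Longrightarrow> y i = x i"
    and diff: "\<And>i z. \<lbrakk>i < p; \<And>j. \<bar>z j - x j\<bar> \<le> \<bar>y j - x j\<bar>\<rbrakk>
      \<Longrightarrow> (\<lambda>t. f (z(i := t))) field_differentiable at (z i)"
    and bound: "\<And>i z. \<lbrakk>i < p; \<And>j. \<bar>z j - x j\<bar> \<le> \<bar>y j - x j\<bar>\<rbrakk> \<Longrightarrow> \<bar>pd i f z\<bar> \<le> B"
  shows "\<bar>f y - f x\<bar> \<le> (\<Sum>i<p. B * \<bar>y i - x i\<bar>)"
proof -
  \<comment> \<open>A path from \<open>x\<close> to \<open>y\<close> along the axes:
    \<open>w k\<close> has already exchanged the first \<open>k\<close> coordinates, so consecutive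
    points differ in one coordinate only.\<close>
  define w where "w k = (\<lambda>i. if i < k then y i else x i)" for k
  have "\<bar>f (w k) - f x\<bar> \<le> (\<Sum>i<k. B * \<bar>y i - x i\<bar>)" if "k \<le> p" for k
    using that
  proof (induction k)
    case 0
    then show ?case by (simp add: w_def)
  next
    case (Suc k)
    have near: "\<bar>((w k)(k := t)) j - x j\<bar> \<le> \<bar>y j - x j\<bar>" if "t \<in> closed_segment (x k) (y k)" for t j
      using that by (auto simp: w_def closed_segment_eq_real_ivl split: if_splits)
    have "norm (f ((w k)(k := y k)) - f ((w k)(k := x k))) \<le> B * norm (y k - x k)"
    proof (rule field_differentiable_bound[where f' = "\<lambda>t. pd k f ((w k)(k := t))"
            and S = "closed_segment (x k) (y k)"])
      fix t assume t: "t \<in> closed_segment (x k) (y k)"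
      have "(\<lambda>s. f ((w k)(k := s))) field_differentiable at t"
        using diff[of k "(w k)(k := t)", OF _ near[OF t]] Suc.prems by (simp only: fun_upd_upd fun_upd_same Suc_le_eq)
      then show "((\<lambda>s. f ((w k)(k := s))) has_field_derivative pd k f ((w k)(k := t)))
          (at t within closed_segment (x k) (y k))"
        by (simp add: pd_def field_differentiable_derivI has_field_derivative_at_within)
      show "norm (pd k f ((w k)(k := t))) \<le> B"
        using bound[of k "(w k)(k := t)", OF _ near[OF t]] Suc.prems by simp
    qed auto
    moreover have "(w k)(k := y k) = w (Suc k)" "(w k)(k := x k) = w k"
      by (auto simp: w_def fun_eq_iff less_Suc_eq)
    ultimately show ?case using Suc by simp
  qed
  moreover have "w p = y" using eq by (auto simp: w_def fun_eq_iff)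
  ultimately show ?thesis by auto
qed

lemma pd_mean_value_bound_box:
  fixes x y :: "nat \<Rightarrow> real"
  assumes x: "x \<in> topspace (Euclidean_space p)" and y: "y \<in> topspace (Euclidean_space p)"
    and near: "\<And>i. i < p \<Longrightarrow> \<bar>y i - x i\<bar> \<le> r" and "r \<ge> 0"
    and diff: "\<And>i z. \<lbrakk>i < p; z \<in> topspace (Euclidean_space p); \<And>j. j < p \<Longrightarrow> \<bar>z j - x j\<bar> \<le> r\<rbrakk>
      \<Longrightarrow> (\<lambda>t. f (z(i := t))) field_differentiable at (z i)"
    and bound: "\<And>i z. \<lbrakk>i < p; z \<in> topspace (Euclidean_space p); \<And>j. j < p \<Longrightarrow> \<bar>z j - x j\<bar> \<le> r\<rbrakk>
      \<Longrightarrow> \<bar>pd i f z\<bar> \<le> B"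
  shows "\<bar>f y - f x\<bar> \<le> real p * r * B"
proof (cases "p = 0")
  case True
  with x y have "x = y" by (auto simp: topspace_Euclidean_space)
  with True show ?thesis by simp
next
  case False
  \<comment> \<open>The sign of \<open>B\<close> follows from the bound at \<open>x\<close> itself
    in coordinate \<open>0\<close>, which exists because \<open>p > 0\<close>.\<close>
  then have "B \<ge> 0" using bound[of 0 x] x \<open>r \<ge> 0\<close> by simp
  have z: "z \<in> topspace (Euclidean_space p) \<and> (\<forall>j<p. \<bar>z j - x j\<bar> \<le> r)"
    if "\<And>j. \<bar>z j - x j\<bar> \<le> \<bar>y j - x j\<bar>" for z
  proof -
    have "z j = 0" if "j \<ge> p" for j
      using that \<open>\<And>j. \<bar>z j - x j\<bar> \<le> \<bar>y j - x j\<bar>\<close>[of j] x y by (simp add: topspace_Euclidean_space)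
    moreover have "\<bar>z j - x j\<bar> \<le> r" if "j < p" for j
      using \<open>\<And>j. \<bar>z j - x j\<bar> \<le> \<bar>y j - x j\<bar>\<close>[of j] near[OF that] by linarith
    ultimately show ?thesis by (simp add: topspace_Euclidean_space)
  qed
  have "\<bar>f y - f x\<bar> \<le> (\<Sum>i<p. B * \<bar>y i - x i\<bar>)"
  proof (rule pd_mean_value_bound)
    show "y i = x i" if "i \<ge> p" for i using that x y by (simp add: topspace_Euclidean_space)
    fix i w assume i: "i < p" and w: "\<And>j. \<bar>w j - x j\<bar> \<le> \<bar>y j - x j\<bar>"
    note w' = conjunct1[OF z[OF w]] mp[OF spec[OF conjunct2[OF z[OF w]]]]
    show "(\<lambda>t. f (w(i := t))) field_differentiable at (w i)" using w' by (rule diff[OF i])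
    show "\<bar>pd i f w\<bar> \<le> B" using w' by (rule bound[OF i])
  qed
  also have "\<dots> \<le> (\<Sum>i<p. B * r)"
    using near \<open>B \<ge> 0\<close> by (intro sum_mono mult_left_mono) auto
  finally show ?thesis by (simp add: mult_ac)
qed

text \<open>In the application \<open>x\<close> is the optimal parameter, \<open>\<alpha>\<close> is
  the rate \<open>a n\<close>, \<open>K * \<alpha>\<close> is the radius of a box that contains the
  QMLE, and \<open>\<eta>\<close> bounds the scaled third derivatives.\<close>

locale third_order_bound =
  fixes p :: nat and S :: "(nat \<Rightarrow> real) set" and f :: "(nat \<Rightarrow> real) \<Rightarrow> real"
    and x :: "nat \<Rightarrow> real" and \<alpha> K \<eta> :: real
  assumes C3: "class_C p 3 S f"
    and x: "x \<in> topspace (Euclidean_space p)"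
    and \<alpha>: "\<alpha> > 0" and K: "K \<ge> 0"
    and box: "\<And>y. \<lbrakk>y \<in> topspace (Euclidean_space p); \<And>i. i < p \<Longrightarrow> \<bar>y i - x i\<bar> \<le> K * \<alpha>\<rbrakk> \<Longrightarrow> y \<in> S"
    and third: "\<And>i j k y. \<lbrakk>i < p; j < p; k < p; y \<in> S\<rbrakk> \<Longrightarrow> \<bar>\<alpha> ^ 3 * pd i (pd j (pd k f)) y\<bar> \<le> \<eta>"
begin

text \<open>A path of at most \<open>p\<close> legs of length \<open>K * \<alpha>\<close>, along
  which the third derivatives are at most \<open>\<eta> / \<alpha> ^ 3\<close>, changes a second
  derivative by a multiple of \<open>\<eta> / \<alpha>\<^sup>2\<close>; the scaling removes the
  rate. A small \<open>\<eta>\<close> thus makes the scaled Hessian almost constant on the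
  box.\<close>

lemma second_derivative_bound:
  assumes "y \<in> topspace (Euclidean_space p)" "\<And>i. i < p \<Longrightarrow> \<bar>y i - x i\<bar> \<le> K * \<alpha>" and "j < p" "k < p"
  shows "\<bar>\<alpha>\<^sup>2 * pd j (pd k f) y - \<alpha>\<^sup>2 * pd j (pd k f) x\<bar> \<le> real p * K * \<eta>"
proof -
  have C1: "class_C p 1 S (pd j (pd k f))"
    using C3 assms(3,4) by (simp add: numeral_3_eq_3)
  have "\<bar>pd j (pd k f) y - pd j (pd k f) x\<bar> \<le> real p * (K * \<alpha>) * (\<eta> / \<alpha> ^ 3)"
  proof (rule pd_mean_value_bound_box[where f = "pd j (pd k f)"])
    fix i z assume z: "i < p" "z \<in> topspace (Euclidean_space p)" "\<And>j. j < p \<Longrightarrow> \<bar>z j - x j\<bar> \<le> K * \<alpha>"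
    then have "z \<in> S" by (intro box) auto
    with C1 z(1) show "(\<lambda>t. pd j (pd k f) (z(i := t))) field_differentiable at (z i)" by simp
    show "\<bar>pd i (pd j (pd k f)) z\<bar> \<le> \<eta> / \<alpha> ^ 3"
      using third[OF z(1) assms(3,4) \<open>z \<in> S\<close>] \<alpha> by (simp add: abs_mult field_simps)
  qed (use assms x \<alpha> K in auto)
  then have "\<alpha>\<^sup>2 * \<bar>pd j (pd k f) y - pd j (pd k f) x\<bar> \<le> \<alpha>\<^sup>2 * (real p * (K * \<alpha>) * (\<eta> / \<alpha> ^ 3))"
    by (intro mult_left_mono) auto
  also have "\<dots> = real p * K * \<eta>" using \<alpha> by (simp add: field_simps eval_nat_numeral)
  finally show ?thesis by (simp add: abs_mult flip: right_diff_distrib)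
qed

text \<open>A Taylor bound built from the top order down: bounds on the second derivatives
  throughout the box control the first derivatives, and these control \<open>f\<close>. Each passage
  costs a factor \<open>p * K\<close>, and all powers of \<open>\<alpha>\<close> cancel.\<close>

lemma function_bound:
  assumes y: "y \<in> topspace (Euclidean_space p)" "\<And>i. i < p \<Longrightarrow> \<bar>y i - x i\<bar> \<le> K * \<alpha>"
    and g: "\<And>k. k < p \<Longrightarrow> \<bar>\<alpha> * pd k f x\<bar> \<le> g"
    and G: "\<And>j k. \<lbrakk>j < p; k < p\<rbrakk> \<Longrightarrow> \<bar>\<alpha>\<^sup>2 * pd j (pd k f) x\<bar> \<le> G"
  shows "\<bar>f y - f x\<bar> \<le> real p * K * (g + real p * K * (G + real p * K * \<eta>))"
proof -
  have first: "\<bar>pd k f z\<bar> \<le> (g + real p * K * (G + real p * K * \<eta>)) / \<alpha>"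
    if "k < p" and z: "z \<in> topspace (Euclidean_space p)" "\<And>i. i < p \<Longrightarrow> \<bar>z i - x i\<bar> \<le> K * \<alpha>" for k z
  proof -
    have C2: "class_C p 2 S (pd k f)"
      using C3 \<open>k < p\<close> by (simp add: numeral_3_eq_3 numeral_2_eq_2)
    have "\<bar>pd k f z - pd k f x\<bar> \<le> real p * (K * \<alpha>) * ((G + real p * K * \<eta>) / \<alpha>\<^sup>2)"
    proof (rule pd_mean_value_bound_box[where f = "pd k f"])
      fix i w assume w: "i < p" "w \<in> topspace (Euclidean_space p)" "\<And>j. j < p \<Longrightarrow> \<bar>w j - x j\<bar> \<le> K * \<alpha>"
      then have "w \<in> S" by (intro box) auto
      with C2 w(1) show "(\<lambda>t. pd k f (w(i := t))) field_differentiable at (w i)"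
        by (simp add: numeral_2_eq_2)
      have "\<bar>\<alpha>\<^sup>2 * pd i (pd k f) w\<bar> \<le> G + real p * K * \<eta>"
        using second_derivative_bound[OF w(2,3,1) \<open>k < p\<close>] G[OF w(1) \<open>k < p\<close>] by linarith
      then show "\<bar>pd i (pd k f) w\<bar> \<le> (G + real p * K * \<eta>) / \<alpha>\<^sup>2"
        using \<alpha> by (simp add: abs_mult field_simps)
    qed (use z x \<alpha> K in auto)
    then have "\<alpha> * \<bar>pd k f z - pd k f x\<bar> \<le> \<alpha> * (real p * (K * \<alpha>) * ((G + real p * K * \<eta>) / \<alpha>\<^sup>2))"
      using \<alpha> by (intro mult_left_mono) auto
    also have "\<dots> = real p * K * (G + real p * K * \<eta>)" using \<alpha> by (simp add: field_simps eval_nat_numeral)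
    finally have "\<bar>\<alpha> * pd k f z - \<alpha> * pd k f x\<bar> \<le> real p * K * (G + real p * K * \<eta>)"
      using \<alpha> by (simp add: abs_mult flip: right_diff_distrib)
    with g[OF \<open>k < p\<close>] have "\<bar>\<alpha> * pd k f z\<bar> \<le> g + real p * K * (G + real p * K * \<eta>)" by linarith
    then show ?thesis using \<alpha> by (simp add: abs_mult field_simps)
  qed
  have "\<bar>f y - f x\<bar> \<le> real p * (K * \<alpha>) * ((g + real p * K * (G + real p * K * \<eta>)) / \<alpha>)"
  proof (rule pd_mean_value_bound_box[where f = f])
    fix i z assume z: "i < p" "z \<in> topspace (Euclidean_space p)" "\<And>j. j < p \<Longrightarrow> \<bar>z j - x j\<bar> \<le> K * \<alpha>"
    then have "z \<in> S" by (intro box) auto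
    with C3 z(1) show "(\<lambda>t. f (z(i := t))) field_differentiable at (z i)"
      by (simp add: numeral_3_eq_3)
  qed (use y x \<alpha> K first in auto)
  also have "\<dots> = real p * K * (g + real p * K * (G + real p * K * \<eta>))"
    using \<alpha> by simp
  finally show ?thesis .
qed

end

section \<open>Determinants\<close>

text \<open>Telescoping, with one factor exchanged at a time. As \<open>R \<ge> 1\<close>, the power
  \<open>R ^ card I\<close> also covers the shorter products.\<close>

lemma abs_prod_diff_le:
  fixes a b :: "'a \<Rightarrow> real" and R \<eta> :: real
  assumes "finite I" and "R \<ge> 1" and "\<eta> \<ge> 0"
    and "\<And>i. i \<in> I \<Longrightarrow> \<bar>a i\<bar> \<le> R" "\<And>i. i \<in> I \<Longrightarrow> \<bar>b i\<bar> \<le> R" "\<And>i. i \<in> I \<Longrightarrow> \<bar>a i - b i\<bar> \<le> \<eta>"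
  shows "\<bar>prod a I - prod b I\<bar> \<le> card I * R ^ card I * \<eta>"
  using assms(1,4-6)
proof (induction I rule: finite_induct)
  case empty
  then show ?case by simp
next
  case (insert i I)
  have "\<bar>prod b I\<bar> \<le> R ^ card I"
    unfolding abs_prod using prod_mono[of I "\<lambda>i. \<bar>b i\<bar>" "\<lambda>_. R"] insert.prems(2) by simp
  have "prod a (insert i I) - prod b (insert i I) = a i * (prod a I - prod b I) + (a i - b i) * prod b I"
    using insert.hyps by (simp add: algebra_simps)
  also have "\<bar>\<dots>\<bar> \<le> \<bar>a i\<bar> * \<bar>prod a I - prod b I\<bar> + \<bar>a i - b i\<bar> * \<bar>prod b I\<bar>"
    by (metis abs_mult abs_triangle_ineq)
  also have "\<dots> \<le> R * (card I * R ^ card I * \<eta>) + \<eta> * R ^ card I"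
    using insert \<open>\<bar>prod b I\<bar> \<le> R ^ card I\<close> assms(2,3) by (intro add_mono mult_mono) auto
  also have "\<dots> \<le> R * (card I * R ^ card I * \<eta>) + \<eta> * R ^ Suc (card I)"
    using assms(2,3) by (intro add_left_mono mult_left_mono power_increasing) auto
  also have "\<dots> = card (insert i I) * R ^ card (insert i I) * \<eta>"
    using insert.hyps by (simp add: algebra_simps)
  finally show ?case .
qed

text \<open>In the Leibniz expansion each of the \<open>fact p\<close> products obeys the
  telescoping bound, and the signs have modulus 1.\<close>

lemma abs_det_diff_le:
  fixes A B :: "real mat" and R \<eta> :: real
  assumes A: "A \<in> carrier_mat p p" and B: "B \<in> carrier_mat p p" and R: "R \<ge> 1" "\<eta> \<ge> 0"
    and bounds: "\<And>i j. \<lbrakk>i < p; j < p\<rbrakk> \<Longrightarrow> \<bar>A $$ (i, j)\<bar> \<le> R" "\<And>i j. \<lbrakk>i < p; j < p\<rbrakk> \<Longrightarrow> \<bar>B $$ (i, j)\<bar> \<le> R"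
      "\<And>i j. \<lbrakk>i < p; j < p\<rbrakk> \<Longrightarrow> \<bar>A $$ (i, j) - B $$ (i, j)\<bar> \<le> \<eta>"
  shows "\<bar>Determinant.det A - Determinant.det B\<bar> \<le> fact p * (p * R ^ p * \<eta>)"
proof -
  let ?S = "{\<sigma>. \<sigma> permutes {0..<p}}"
  let ?D = "\<lambda>\<sigma>. (\<Prod>i = 0..<p. A $$ (i, \<sigma> i)) - (\<Prod>i = 0..<p. B $$ (i, \<sigma> i))"
  have "\<bar>Determinant.det A - Determinant.det B\<bar> = \<bar>\<Sum>\<sigma>\<in>?S. of_int (sign \<sigma>) * ?D \<sigma>\<bar>"
    by (simp add: det_def'[OF A] det_def'[OF B] sum_subtractf right_diff_distrib)
  also have "\<dots> \<le> (\<Sum>\<sigma>\<in>?S. \<bar>of_int (sign \<sigma>) * ?D \<sigma>\<bar>)" by (rule sum_abs)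
  also have "\<dots> \<le> (\<Sum>\<sigma>\<in>?S. p * R ^ p * \<eta>)"
  proof (rule sum_mono)
    fix \<sigma> assume \<sigma>: "\<sigma> \<in> ?S"
    then have "\<sigma> i < p" if "i < p" for i using that permutes_in_image[of \<sigma> "{0..<p}" i] by auto
    then have "\<bar>?D \<sigma>\<bar> \<le> card {0..<p} * R ^ card {0..<p} * \<eta>"
      using R bounds by (intro abs_prod_diff_le) auto
    then show "\<bar>of_int (sign \<sigma>) * ?D \<sigma>\<bar> \<le> p * R ^ p * \<eta>"
      by (simp add: abs_mult sign_def)
  qed
  also have "\<dots> = fact p * (p * R ^ p * \<eta>)" by (simp add: card_permutations)
  finally show ?thesis .
qed

lemma smult_mat_mult_vec:
  "dim_vec v = dim_col A \<Longrightarrow> (k \<cdot>\<^sub>m A) *\<^sub>v v = k \<cdot>\<^sub>v (A *\<^sub>v (v :: real vec))"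
  by (intro eq_vecI) (auto simp: scalar_prod_def sum_distrib_left mult.assoc)

text \<open>The segment from the identity to a positive definite matrix avoids singular matrices.\<close>

lemma pos_definite_det_pos:
  assumes "pos_definite p A"
  shows "Determinant.det A > 0"
proof (rule ccontr)
  assume neg: "\<not> Determinant.det A > 0"
  have A: "A \<in> carrier_mat p p" using assms by (simp add: pos_definite_def)
  define B where "B t = t \<cdot>\<^sub>m A + (1 - t) \<cdot>\<^sub>m 1\<^sub>m p" for t
  have B: "B t \<in> carrier_mat p p" for t using A by (simp add: B_def)
  have "isCont (\<lambda>t. Determinant.det (B t)) t" for t
    unfolding det_def'[OF B]
  proof (intro continuous_intros)
    fix \<sigma> i assume "\<sigma> \<in> {\<sigma>. \<sigma> permutes {0..<p}}" "i \<in> {0..<p}"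
    then have "i < p" "\<sigma> i < p" using permutes_in_image[of \<sigma> "{0..<p}" i] by auto
    then have "(\<lambda>t. B t $$ (i, \<sigma> i)) = (\<lambda>t. t * A $$ (i, \<sigma> i) + (1 - t) * (1\<^sub>m p $$ (i, \<sigma> i)))"
      using A by (auto simp: B_def)
    then show "isCont (\<lambda>t. B t $$ (i, \<sigma> i)) t" by (simp del: index_one_mat)
  qed
  moreover have "Determinant.det (B 0) = 1"
  proof -
    have "B 0 = 1\<^sub>m p" using A by (intro eq_matI) (auto simp: B_def)
    then show ?thesis by simp
  qed
  moreover have "B 1 = A" using A by (intro eq_matI) (auto simp: B_def)
  \<comment> \<open>The intermediate value theorem yields a singular matrix on the segment. A vector
    \<open>v\<close> in its kernel makes the quadratic form of \<open>B t\<close> vanish, although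
    this form is a convex combination of two positive numbers.\<close>
  ultimately obtain t where t: "0 \<le> t" "t \<le> 1" "Determinant.det (B t) = 0"
    using IVT2[of "\<lambda>t. Determinant.det (B t)" 1 0 0] neg by auto
  then obtain v where v: "v \<in> carrier_vec p" "v \<noteq> 0\<^sub>v p" "B t *\<^sub>v v = 0\<^sub>v p"
    using det_0_iff_vec_prod_zero[OF B] by blast
  have Av: "A *\<^sub>v v \<in> carrier_vec p" using A v(1) by (rule mult_mat_vec_carrier)
  have "B t *\<^sub>v v = t \<cdot>\<^sub>v (A *\<^sub>v v) + (1 - t) \<cdot>\<^sub>v v"
    using A v(1) by (simp add: B_def add_mult_distrib_mat_vec[where nr = p and nc = p] smult_mat_mult_vec)
  with v(3) have "v \<bullet> (t \<cdot>\<^sub>v (A *\<^sub>v v) + (1 - t) \<cdot>\<^sub>v v) = v \<bullet> 0\<^sub>v p" by simp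
  also have "\<dots> = 0" using v(1) by simp
  finally have "v \<bullet> (t \<cdot>\<^sub>v (A *\<^sub>v v) + (1 - t) \<cdot>\<^sub>v v) = 0" .
  then have *: "t * (v \<bullet> (A *\<^sub>v v)) + (1 - t) * (v \<bullet> v) = 0"
    using v(1) Av by (simp add: scalar_prod_add_distrib[where n = p])
  have "v \<bullet> (A *\<^sub>v v) > 0" using assms v by (simp add: pos_definite_def)
  moreover have "v \<bullet> v > 0"
    using v(1,2) conjugate_square_greater_0_vec[of v p] by simp
  ultimately show False using * t(1,2) 
    by (smt (verit) mult_nonneg_nonneg mult_pos_pos)
qed

section \<open>Stochastic boundedness\<close>

text \<open>The parameter \<open>C\<close> plays the role of a bound: for every \<open>\<epsilon> > 0\<close> the property
  \<open>Q C n\<close> fails with probability at most \<open>\<epsilon>\<close> if first \<open>C\<close> and then \<open>n\<close> is large.  A property that does not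
  depend on \<open>C\<close> holds with probability tending to \<open>1\<close>.\<close>

definition tightly :: "'w measure \<Rightarrow> (real \<Rightarrow> nat \<Rightarrow> 'w \<Rightarrow> bool) \<Rightarrow> bool" where
  "tightly P Q \<longleftrightarrow> (\<forall>\<epsilon>>0. \<forall>\<^sub>F C in at_top. \<forall>\<^sub>F n in sequentially.
     \<exists>A\<in>sets P. (\<forall>\<omega>\<in>space P - A. Q C n \<omega>) \<and> emeasure P A \<le> ennreal \<epsilon>)"

lemma tightly_mono:
  assumes "tightly P Q"
    and "\<forall>\<^sub>F C in at_top. \<forall>\<^sub>F n in sequentially. \<forall>\<omega>\<in>space P. Q C n \<omega> \<longrightarrow> R C n \<omega>"
  shows "tightly P R"
  unfolding tightly_def
proof (intro allI impI)
  fix \<epsilon> :: real assume "\<epsilon> > 0"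
  with assms(1) have "\<forall>\<^sub>F C in at_top. \<forall>\<^sub>F n in sequentially.
     \<exists>A\<in>sets P. (\<forall>\<omega>\<in>space P - A. Q C n \<omega>) \<and> emeasure P A \<le> ennreal \<epsilon>"
    by (simp add: tightly_def)
  with assms(2) show "\<forall>\<^sub>F C in at_top. \<forall>\<^sub>F n in sequentially.
     \<exists>A\<in>sets P. (\<forall>\<omega>\<in>space P - A. R C n \<omega>) \<and> emeasure P A \<le> ennreal \<epsilon>"
  proof eventually_elim
    case (elim C)
    from elim show ?case
    proof eventually_elim
      case (elim n)
      then obtain A where "A \<in> sets P" "\<forall>\<omega>\<in>space P - A. Q C n \<omega>" "emeasure P A \<le> ennreal \<epsilon>"
        by (elim bexE conjE)
      with elim(1) show ?case by (intro bexI[of _ A]) auto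
    qed
  qed
qed

text \<open>The union bound with \<open>\<epsilon> / 2\<close> for each property. Because the
  definition asks for all large \<open>C\<close> and not for some \<open>C\<close>, one value of
  \<open>C\<close> serves both properties without any monotonicity.\<close>

lemma tightly_conj:
  assumes "tightly P Q" "tightly P R"
  shows "tightly P (\<lambda>C n \<omega>. Q C n \<omega> \<and> R C n \<omega>)"
  unfolding tightly_def
proof (intro allI impI)
  fix \<epsilon> :: real assume "\<epsilon> > 0"
  then have "\<epsilon> / 2 > 0" by simp
  with assms have "\<forall>\<^sub>F C in at_top. \<forall>\<^sub>F n in sequentially.
      \<exists>A\<in>sets P. (\<forall>\<omega>\<in>space P - A. Q C n \<omega>) \<and> emeasure P A \<le> ennreal (\<epsilon> / 2)"
    "\<forall>\<^sub>F C in at_top. \<forall>\<^sub>F n in sequentially.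
      \<exists>A\<in>sets P. (\<forall>\<omega>\<in>space P - A. R C n \<omega>) \<and> emeasure P A \<le> ennreal (\<epsilon> / 2)"
    unfolding tightly_def by simp_all
  then show "\<forall>\<^sub>F C in at_top. \<forall>\<^sub>F n in sequentially.
     \<exists>A\<in>sets P. (\<forall>\<omega>\<in>space P - A. Q C n \<omega> \<and> R C n \<omega>) \<and> emeasure P A \<le> ennreal \<epsilon>"
  proof eventually_elim
    case (elim C)
    from elim show ?case
    proof eventually_elim
      case (elim n)
      then obtain A B where AB: "A \<in> sets P" "\<forall>\<omega>\<in>space P - A. Q C n \<omega>" "emeasure P A \<le> ennreal (\<epsilon> / 2)"
        "B \<in> sets P" "\<forall>\<omega>\<in>space P - B. R C n \<omega>" "emeasure P B \<le> ennreal (\<epsilon> / 2)"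
        by (elim bexE conjE)
      have "emeasure P (A \<union> B) \<le> emeasure P A + emeasure P B"
        using AB by (intro emeasure_subadditive)
      also have "\<dots> \<le> ennreal (\<epsilon> / 2) + ennreal (\<epsilon> / 2)" using AB by (intro add_mono)
      also have "\<dots> = ennreal \<epsilon>" using \<open>\<epsilon> > 0\<close> by (simp flip: ennreal_plus)
      finally have "emeasure P (A \<union> B) \<le> ennreal \<epsilon>" .
      with AB show ?case by (intro bexI[of _ "A \<union> B"]) auto
    qed
  qed
qed

lemma tightly_always:
  assumes "\<And>n. AE \<omega> in P. Q n \<omega>"
  shows "tightly P (\<lambda>C. Q)"
proof -
  have "\<exists>A\<in>sets P. (\<forall>\<omega>\<in>space P - A. Q n \<omega>) \<and> emeasure P A \<le> ennreal \<epsilon>" for n \<epsilon>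
  proof -
    obtain N where N: "{\<omega> \<in> space P. \<not> Q n \<omega>} \<subseteq> N" "emeasure P N = 0" "N \<in> sets P"
      using AE_E[OF assms[of n]] .
    show ?thesis by (rule bexI[OF _ N(3)]) (use N(1,2) in auto)
  qed
  then show ?thesis unfolding tightly_def by simp
qed

lemma tightly_ball:
  assumes "finite I" "\<And>i. i \<in> I \<Longrightarrow> tightly P (Q i)"
  shows "tightly P (\<lambda>C n \<omega>. \<forall>i\<in>I. Q i C n \<omega>)"
  using assms
proof (induction I rule: finite_induct)
  case empty
  show ?case by (simp add: tightly_always)
next
  case (insert i I)
  then show ?case using tightly_conj[of P "Q i" "\<lambda>C n \<omega>. \<forall>i\<in>I. Q i C n \<omega>"] by simp
qed

text \<open>For a property that is monotone in \<open>C\<close>, a single good value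
  \<open>g C\<close> already gives all larger ones. This permits replacing a bound computed from
  \<open>C\<close> by \<open>C\<close> itself.\<close>

lemma tightly_reparam:
  assumes "tightly P (\<lambda>C. Q (g C))" and "\<And>C C' n \<omega>. \<lbrakk>C \<le> C'; \<omega> \<in> space P; Q C n \<omega>\<rbrakk> \<Longrightarrow> Q C' n \<omega>"
  shows "tightly P Q"
  unfolding tightly_def
proof (intro allI impI)
  fix \<epsilon> :: real assume "\<epsilon> > 0"
  with assms(1) have "\<forall>\<^sub>F C in at_top. \<forall>\<^sub>F n in sequentially.
      \<exists>A\<in>sets P. (\<forall>\<omega>\<in>space P - A. Q (g C) n \<omega>) \<and> emeasure P A \<le> ennreal \<epsilon>"
    by (simp add: tightly_def)
  then obtain C where C: "\<forall>\<^sub>F n in sequentially.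
      \<exists>A\<in>sets P. (\<forall>\<omega>\<in>space P - A. Q (g C) n \<omega>) \<and> emeasure P A \<le> ennreal \<epsilon>"
    using eventually_happens'[OF trivial_limit_at_top_linorder] by fast
  show "\<forall>\<^sub>F C in at_top. \<forall>\<^sub>F n in sequentially.
     \<exists>A\<in>sets P. (\<forall>\<omega>\<in>space P - A. Q C n \<omega>) \<and> emeasure P A \<le> ennreal \<epsilon>"
    using eventually_ge_at_top[of "g C"]
  proof eventually_elim
    case (elim C')
    from C show ?case
    proof eventually_elim
      case (elim n)
      then obtain A where "A \<in> sets P" "\<And>\<omega>. \<omega> \<in> space P - A \<Longrightarrow> Q (g C) n \<omega>" "emeasure P A \<le> ennreal \<epsilon>"
        by (elim bexE conjE) simp
      then show ?case using assms(2)[OF \<open>g C \<le> C'\<close>] by (intro bexI[of _ A]) auto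
    qed
  qed
qed

text \<open>Outer measure is attained by a measurable superset, which becomes the exceptional
  set.\<close>

lemma outer_measure_of_le_obtain:
  assumes "outer_measure_of P {\<omega> \<in> space P. \<not> Q \<omega>} \<le> \<epsilon>"
  shows "\<exists>A\<in>sets P. (\<forall>\<omega>\<in>space P - A. Q \<omega>) \<and> emeasure P A \<le> \<epsilon>"
proof -
  have "{\<omega> \<in> space P. \<not> Q \<omega>} \<subseteq> space P" by blast
  from outer_measure_of_attain[OF this]
  obtain A where "A \<in> sets P" "{\<omega> \<in> space P. \<not> Q \<omega>} \<subseteq> A"
    "outer_measure_of P {\<omega> \<in> space P. \<not> Q \<omega>} = emeasure P A"
    by (elim bexE conjE)
  with assms show ?thesis by (intro bexI[of _ A]) auto
qed

text \<open>The tolerance \<open>h C\<close> may shrink as \<open>C\<close> grows, because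
  \<open>C\<close> is fixed before \<open>n\<close> tends to infinity. Thus errors can be made small
  relative to bounds that are only known to be tight.\<close>

lemma tightly_small_op1:
  assumes "small_op1 P X" and "\<forall>\<^sub>F C in at_top. h C > 0"
  shows "tightly P (\<lambda>C n \<omega>. X n \<omega> \<le> ennreal (h C))"
  unfolding tightly_def
proof (intro allI impI)
  fix \<epsilon> :: real assume "\<epsilon> > 0"
  from assms(2) show "\<forall>\<^sub>F C in at_top. \<forall>\<^sub>F n in sequentially.
     \<exists>A\<in>sets P. (\<forall>\<omega>\<in>space P - A. X n \<omega> \<le> ennreal (h C)) \<and> emeasure P A \<le> ennreal \<epsilon>"
  proof eventually_elim
    case (elim C)
    then have "(\<lambda>n. outer_measure_of P {\<omega> \<in> space P. X n \<omega> > ennreal (h C)}) \<longlonglongrightarrow> 0"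
      using assms(1) by (simp add: small_op1_def)
    then have "\<forall>\<^sub>F n in sequentially. outer_measure_of P {\<omega> \<in> space P. X n \<omega> > ennreal (h C)} < ennreal \<epsilon>"
      using \<open>\<epsilon> > 0\<close> by (intro order_tendstoD(2)) auto
    then show ?case
      by eventually_elim (intro outer_measure_of_le_obtain, simp add: not_le)
  qed
qed

lemma tightly_big_Op1:
  assumes "big_Op1 P X"
  shows "tightly P (\<lambda>C n \<omega>. X n \<omega> \<le> ennreal C)"
  unfolding tightly_def
proof (intro allI impI)
  fix \<epsilon> :: real assume "\<epsilon> > 0"
  with assms have "\<exists>K. \<exists>N. \<forall>n\<ge>N. outer_measure_of P {\<omega> \<in> space P. X n \<omega> > ennreal K} < ennreal \<epsilon>"
    by (simp only: big_Op1_def)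
  then obtain K where "\<exists>N. \<forall>n\<ge>N. outer_measure_of P {\<omega> \<in> space P. X n \<omega> > ennreal K} < ennreal \<epsilon>" ..
  then obtain N where K: "\<forall>n\<ge>N. outer_measure_of P {\<omega> \<in> space P. X n \<omega> > ennreal K} < ennreal \<epsilon>" ..
  show "\<forall>\<^sub>F C in at_top. \<forall>\<^sub>F n in sequentially.
     \<exists>A\<in>sets P. (\<forall>\<omega>\<in>space P - A. X n \<omega> \<le> ennreal C) \<and> emeasure P A \<le> ennreal \<epsilon>"
    using eventually_ge_at_top[of K]
  proof eventually_elim
    case (elim C)
    from eventually_ge_at_top[of N] show ?case
    proof eventually_elim
      case (elim n)
      have "\<exists>A\<in>sets P. (\<forall>\<omega>\<in>space P - A. X n \<omega> \<le> ennreal K) \<and> emeasure P A \<le> ennreal \<epsilon>"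
        using K elim by (intro outer_measure_of_le_obtain) (simp add: not_le less_imp_le)
      then obtain A where "A \<in> sets P" "\<And>\<omega>. \<omega> \<in> space P - A \<Longrightarrow> X n \<omega> \<le> ennreal K" "emeasure P A \<le> ennreal \<epsilon>"
        by (elim bexE conjE) simp
      then show ?case using order_trans[OF _ ennreal_leI[OF \<open>K \<le> C\<close>]] by (intro bexI[of _ A]) auto
    qed
  qed
qed

section \<open>Tightness on a probability space\<close>

context prob_space
begin

lemma tightly_of_events:
  assumes "\<And>C n. {\<omega> \<in> space M. \<not> Q C n \<omega>} \<in> events"
    and "\<And>\<epsilon>. \<epsilon> > 0 \<Longrightarrow> \<forall>\<^sub>F C in at_top. \<forall>\<^sub>F n in sequentially. prob {\<omega> \<in> space M. \<not> Q C n \<omega>} \<le> \<epsilon>"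
  shows "tightly M Q"
  unfolding tightly_def
proof (intro allI impI)
  fix \<epsilon> :: real assume "\<epsilon> > 0"
  from assms(2)[OF this] show "\<forall>\<^sub>F C in at_top. \<forall>\<^sub>F n in sequentially.
     \<exists>A\<in>sets M. (\<forall>\<omega>\<in>space M - A. Q C n \<omega>) \<and> emeasure M A \<le> ennreal \<epsilon>"
  proof eventually_elim
    case (elim C)
    then show ?case
    proof eventually_elim
      case (elim n)
      then have "emeasure M {\<omega> \<in> space M. \<not> Q C n \<omega>} \<le> ennreal \<epsilon>"
        by (simp only: emeasure_eq_measure) (rule ennreal_leI)
      with assms(1)[of C n] show ?case by (intro bexI[of _ "{\<omega> \<in> space M. \<not> Q C n \<omega>}"]) auto
    qed
  qed
qed

text \<open>The events where the real number \<open>\<bar>X \<omega>\<bar>\<close> exceeds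
  \<open>k\<close> decrease to the empty set, so their probabilities tend to 0.\<close>

lemma tightly_random_variable:
  fixes X :: "'a \<Rightarrow> real"
  assumes [measurable]: "X \<in> borel_measurable M"
  shows "tightly M (\<lambda>C n \<omega>. \<bar>X \<omega>\<bar> \<le> C)"
proof (rule tightly_of_events)
  fix \<epsilon> :: real assume "\<epsilon> > 0"
  have "(\<lambda>k. prob {\<omega> \<in> space M. \<not> \<bar>X \<omega>\<bar> \<le> real k}) \<longlonglongrightarrow> prob (\<Inter>k. {\<omega> \<in> space M. \<not> \<bar>X \<omega>\<bar> \<le> real k})"
  proof (rule finite_Lim_measure_decseq)
    show "range (\<lambda>k. {\<omega> \<in> space M. \<not> \<bar>X \<omega>\<bar> \<le> real k}) \<subseteq> events" by (intro image_subsetI) measurable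
  qed (auto intro!: decseq_SucI)
  also have "(\<Inter>k. {\<omega> \<in> space M. \<not> \<bar>X \<omega>\<bar> \<le> real k}) = {}"
  proof -
    have "\<exists>k. \<bar>X \<omega>\<bar> \<le> real k" for \<omega> by (rule real_arch_simple)
    then show ?thesis by blast
  qed
  finally have "\<forall>\<^sub>F k in sequentially. prob {\<omega> \<in> space M. \<not> \<bar>X \<omega>\<bar> \<le> real k} < \<epsilon>"
    using \<open>\<epsilon> > 0\<close> by (intro order_tendstoD(2)) auto
  then obtain k where k: "prob {\<omega> \<in> space M. \<not> \<bar>X \<omega>\<bar> \<le> real k} < \<epsilon>"
    using eventually_happens'[OF sequentially_bot] by fast
  have "prob {\<omega> \<in> space M. \<not> \<bar>X \<omega>\<bar> \<le> C} \<le> \<epsilon>" if "C \<ge> real k" for C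
  proof -
    have "prob {\<omega> \<in> space M. \<not> \<bar>X \<omega>\<bar> \<le> C} \<le> prob {\<omega> \<in> space M. \<not> \<bar>X \<omega>\<bar> \<le> real k}"
      using that by (intro finite_measure_mono) auto
    with k show ?thesis by simp
  qed
  then show "\<forall>\<^sub>F C in at_top. \<forall>\<^sub>F n in sequentially. prob {\<omega> \<in> space M. \<not> \<bar>X \<omega>\<bar> \<le> C} \<le> \<epsilon>"
    by (intro eventually_mono[OF eventually_ge_at_top[of "real k"]]) auto
qed measurable

text \<open>Tightness of the reciprocal. This quantifies strict positivity, both of a determinant
  and of the gap between two limits.\<close>

lemma tightly_positive_random_variable:
  fixes X :: "'a \<Rightarrow> real"
  assumes "X \<in> borel_measurable M" and "AE \<omega> in M. X \<omega> > 0"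
  shows "tightly M (\<lambda>C n \<omega>. X \<omega> \<ge> 1 / C)"
proof -
  have "tightly M (\<lambda>C n \<omega>. \<bar>1 / X \<omega>\<bar> \<le> C \<and> X \<omega> > 0)"
    using assms by (intro tightly_conj tightly_random_variable tightly_always) auto
  then show ?thesis
  proof (rule tightly_mono)
    have "X \<omega> \<ge> 1 / C" if "C > 0" "\<bar>1 / X \<omega>\<bar> \<le> C" "X \<omega> > 0" for C \<omega>
      using that by (simp add: field_simps)
    then show "\<forall>\<^sub>F C in at_top. \<forall>\<^sub>F n in sequentially. \<forall>\<omega>\<in>space M.
        \<bar>1 / X \<omega>\<bar> \<le> C \<and> X \<omega> > 0 \<longrightarrow> X \<omega> \<ge> 1 / C"
      by (intro eventually_mono[OF eventually_gt_at_top[of 0]]) auto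
  qed
qed

text \<open>Exceptional sets of probability at most \<open>inverse (real (Suc k))\<close> exist for
  every \<open>k\<close>; all of them contain the points where \<open>Q\<close> fails, and their
  intersection is null.\<close>

lemma tightly_AE:
  assumes "tightly M (\<lambda>C n. Q)"
  shows "AE \<omega> in M. Q \<omega>"
proof -
  have *: "\<exists>A\<in>events. (\<forall>\<omega>\<in>space M - A. Q \<omega>) \<and> emeasure M A \<le> ennreal (inverse (real (Suc k)))" for k
  proof -
    have "\<forall>\<^sub>F C in at_top :: real filter. \<forall>\<^sub>F n in sequentially.
       \<exists>A\<in>events. (\<forall>\<omega>\<in>space M - A. Q \<omega>) \<and> emeasure M A \<le> ennreal (inverse (real (Suc k)))"
      using assms by (simp add: tightly_def del: of_nat_Suc)
    then show ?thesis by simp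
  qed
  then obtain A where A: "\<And>k. A k \<in> events" "\<And>k \<omega>. \<omega> \<in> space M - A k \<Longrightarrow> Q \<omega>"
    "\<And>k. emeasure M (A k) \<le> ennreal (inverse (real (Suc k)))"
    by metis
  show ?thesis
  proof (rule AE_I)
    show "{\<omega> \<in> space M. \<not> Q \<omega>} \<subseteq> (\<Inter>k. A k)" using A(2) by blast
    show "(\<Inter>k. A k) \<in> events" using A(1) by auto
    have "prob (\<Inter>k. A k) \<le> inverse (real (Suc k))" for k
    proof -
      have "prob (\<Inter>k. A k) \<le> prob (A k)" using A(1) by (intro finite_measure_mono) auto
      also have "\<dots> \<le> inverse (real (Suc k))"
        using A(3)[of k] by (simp add: emeasure_eq_measure)
      finally show ?thesis .
    qed
    then have "prob (\<Inter>k. A k) \<le> 0"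
      by (intro LIMSEQ_le_const[OF LIMSEQ_inverse_real_of_nat]) auto
    then show "emeasure M (\<Inter>k. A k) = 0" by (simp add: emeasure_eq_measure measure_le_0_iff)
  qed
qed

text \<open>The complement of the exceptional set is a measurable subset of the event, hence a
  competitor in the supremum defining the inner probability.\<close>

lemma inner_prob_tendsto_1:
  assumes "tightly M (\<lambda>C. Q)"
  shows "(\<lambda>n. inner_prob M {\<omega> \<in> space M. Q n \<omega>}) \<longlonglongrightarrow> 1"
proof (rule tendstoI)
  fix \<epsilon> :: real assume "\<epsilon> > 0"
  have bdd: "bdd_above (prob ` {A \<in> events. A \<subseteq> S})" for S by (rule bdd_aboveI[of _ 1]) auto
  have le: "inner_prob M S \<le> 1" for S unfolding inner_prob_def by (rule cSUP_least) auto
  have "\<epsilon> / 2 > 0" using \<open>\<epsilon> > 0\<close> by simp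
  with assms have "\<forall>\<^sub>F C in at_top :: real filter. \<forall>\<^sub>F n in sequentially.
     \<exists>A\<in>events. (\<forall>\<omega>\<in>space M - A. Q n \<omega>) \<and> emeasure M A \<le> ennreal (\<epsilon> / 2)"
    unfolding tightly_def by simp
  then have "\<forall>\<^sub>F n in sequentially. \<exists>A\<in>events. (\<forall>\<omega>\<in>space M - A. Q n \<omega>) \<and> emeasure M A \<le> ennreal (\<epsilon> / 2)"
    by simp
  then show "\<forall>\<^sub>F n in sequentially. dist (inner_prob M {\<omega> \<in> space M. Q n \<omega>}) 1 < \<epsilon>"
  proof eventually_elim
    case (elim n)
    then obtain A where A: "A \<in> events" "\<And>\<omega>. \<omega> \<in> space M - A \<Longrightarrow> Q n \<omega>" "prob A \<le> \<epsilon> / 2"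
      using \<open>\<epsilon> > 0\<close> by (auto simp: emeasure_eq_measure)
    have "prob (space M - A) \<le> inner_prob M {\<omega> \<in> space M. Q n \<omega>}"
      unfolding inner_prob_def using A by (intro cSUP_upper bdd) auto
    then have "1 - \<epsilon> / 2 \<le> inner_prob M {\<omega> \<in> space M. Q n \<omega>}"
      using A by (simp add: prob_compl)
    then show ?case using le[of "{\<omega> \<in> space M. Q n \<omega>}"] \<open>\<epsilon> > 0\<close> by (simp add: dist_real_def)
  qed
qed

end

text \<open>With probability close to 1 both limits are within \<open>inverse (real (Suc k))\<close>
  of a common value. Their distance involves no \<open>n\<close>, so the resulting bound holds
  almost surely for every \<open>k\<close>.\<close>

lemma (in prob_space) small_op1_limit_unique:
  fixes X :: "nat \<Rightarrow> 'a \<Rightarrow> real"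
  assumes "small_op1 M (\<lambda>n \<omega>. ennreal \<bar>X n \<omega> - L \<omega>\<bar>)" "small_op1 M (\<lambda>n \<omega>. ennreal \<bar>Y n \<omega> - L' \<omega>\<bar>)"
    and "\<And>n. AE \<omega> in M. X n \<omega> = Y n \<omega>"
  shows "AE \<omega> in M. L \<omega> = L' \<omega>"
proof -
  have "AE \<omega> in M. \<bar>L \<omega> - L' \<omega>\<bar> \<le> 2 * inverse (real (Suc k))" for k
  proof (rule tightly_AE)
    let ?h = "inverse (real (Suc k))"
    have "tightly M (\<lambda>C n \<omega>. X n \<omega> = Y n \<omega> \<and> ennreal \<bar>X n \<omega> - L \<omega>\<bar> \<le> ennreal ?h \<and> ennreal \<bar>Y n \<omega> - L' \<omega>\<bar> \<le> ennreal ?h)"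
      using assms by (intro tightly_conj tightly_always tightly_small_op1) auto
    then show "tightly M (\<lambda>C n \<omega>. \<bar>L \<omega> - L' \<omega>\<bar> \<le> 2 * ?h)"
      by (rule tightly_mono) (intro always_eventually allI ballI impI, auto simp del: of_nat_Suc)
  qed
  then have "AE \<omega> in M. \<forall>k. \<bar>L \<omega> - L' \<omega>\<bar> \<le> 2 * inverse (real (Suc k))"
    by (simp add: AE_all_countable)
  then show ?thesis
  proof eventually_elim
    case (elim \<omega>)
    have "(\<lambda>k. 2 * inverse (real (Suc k))) \<longlonglongrightarrow> 2 * 0"
      by (intro tendsto_intros LIMSEQ_inverse_real_of_nat)
    then have "\<bar>L \<omega> - L' \<omega>\<bar> \<le> 2 * 0"
      by (rule LIMSEQ_le_const) (use elim in blast)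
    then show ?case by simp
  qed
qed

lemma L2_set_borel_measurable [measurable]: "(\<lambda>x. L2_set x {..<p}) \<in> borel_measurable (borel :: (nat \<Rightarrow> real) measure)"
  unfolding L2_set_def by measurable

text \<open>Convergence in distribution implies tightness: a continuous cutoff replaces the
  indicator of a large norm. Its integral is small under \<open>L\<close>, hence also under the law
  of \<open>X n\<close> for large \<open>n\<close>.\<close>

lemma (in prob_space) converges_in_distr_tightly:
  assumes L: "prob_space L" "sets L = sets (borelE p)"
    and X: "\<And>n i. i < p \<Longrightarrow> (\<lambda>\<omega>. X n \<omega> i) \<in> borel_measurable M"
    and conv: "converges_in_distr M p X L"
  shows "tightly M (\<lambda>C n \<omega>. L2_set (X n \<omega>) {..<p} \<le> C)"
proof (rule tightly_of_events)
  interpret L: prob_space L by fact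
  have [measurable]: "(\<lambda>\<omega>. L2_set (X n \<omega>) {..<p}) \<in> borel_measurable M" for n
    unfolding L2_set_def using X by (intro measurable_compose[OF _ borel_measurable_sqrt] borel_measurable_sum borel_measurable_power) auto
  show "{\<omega> \<in> space M. \<not> L2_set (X n \<omega>) {..<p} \<le> C} \<in> events" for C n
    by measurable
  fix \<epsilon> :: real assume "\<epsilon> > 0"
  \<comment> \<open>The cutoff vanishes on the ball of radius \<open>K\<close>, equals 1 outside the
    ball of radius \<open>K + 1\<close>, and is continuous and bounded in between.\<close>
  define f where "f K x = min 1 (max 0 (L2_set x {..<p} - K))" for K and x :: "nat \<Rightarrow> real"
  have f01: "0 \<le> f K x" "f K x \<le> 1" for K x by (auto simp: f_def)
  have "f K \<in> borel_measurable (restrict_space borel (topspace (Euclidean_space p)))" for K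
    unfolding f_def by (intro measurable_restrict_space1) measurable
  then have f_meas [measurable]: "f K \<in> borel_measurable L" for K
    using L(2) by (simp add: borelE_def cong: measurable_cong_sets)
  have "(\<lambda>k. \<integral>x. f (real k) x \<partial>L) \<longlonglongrightarrow> (\<integral>x. 0 \<partial>L)"
  proof (rule integral_dominated_convergence[where w = "\<lambda>_. 1"])
    show "AE x in L. (\<lambda>k. f (real k) x) \<longlonglongrightarrow> 0"
    proof (rule AE_I2)
      fix x
      obtain k0 where "L2_set x {..<p} \<le> real k0" using real_arch_simple by blast
      then have "\<forall>\<^sub>F k in sequentially. f (real k) x = 0"
        by (intro eventually_sequentiallyI[of k0]) (auto simp: f_def)
      then show "(\<lambda>k. f (real k) x) \<longlonglongrightarrow> 0" by (rule tendsto_eventually)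
    qed
  qed (use f01 in auto)
  then have "\<forall>\<^sub>F k in sequentially. (\<integral>x. f (real k) x \<partial>L) < \<epsilon>"
    using \<open>\<epsilon> > 0\<close> by (intro order_tendstoD(2)) auto
  then obtain k where k: "(\<integral>x. f (real k) x \<partial>L) < \<epsilon>"
    using eventually_happens'[OF sequentially_bot] by fast
  have "continuous_on UNIV (\<lambda>x :: nat \<Rightarrow> real. f (real k) x)"
    unfolding f_def L2_set_def by (intro continuous_intros) (auto intro: continuous_on_product_coordinates)
  then have "continuous_map (Euclidean_space p) euclideanreal (f (real k))"
    unfolding continuous_map_Euclidean_space_iff by (rule continuous_on_subset) simp
  moreover have "\<forall>x. \<bar>f (real k) x\<bar> \<le> 1" using f01 by auto
  ultimately have "(\<lambda>n. \<integral>\<omega>. f (real k) (X n \<omega>) \<partial>M) \<longlonglongrightarrow> (\<integral>x. f (real k) x \<partial>L)"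
    using conv unfolding converges_in_distr_def by blast
  then have ev: "\<forall>\<^sub>F n in sequentially. (\<integral>\<omega>. f (real k) (X n \<omega>) \<partial>M) < \<epsilon>"
    using k by (rule order_tendstoD(2))
  have bound: "prob {\<omega> \<in> space M. \<not> L2_set (X n \<omega>) {..<p} \<le> C} \<le> (\<integral>\<omega>. f (real k) (X n \<omega>) \<partial>M)"
    if "C \<ge> real k + 1" for C n
  proof -
    have "prob {\<omega> \<in> space M. \<not> L2_set (X n \<omega>) {..<p} \<le> C}
        = (\<integral>\<omega>. indicator {\<omega> \<in> space M. \<not> L2_set (X n \<omega>) {..<p} \<le> C} \<omega> \<partial>M)"
      by simp
    also have "\<dots> \<le> (\<integral>\<omega>. f (real k) (X n \<omega>) \<partial>M)"
    proof (rule integral_mono)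
      show "integrable M (indicat_real {\<omega> \<in> space M. \<not> L2_set (X n \<omega>) {..<p} \<le> C})"
        by (intro integrable_const_bound[where B = 1]) (auto simp: indicator_def)
      have "(\<lambda>\<omega>. f (real k) (X n \<omega>)) \<in> borel_measurable M" unfolding f_def by measurable
      then show "integrable M (\<lambda>\<omega>. f (real k) (X n \<omega>))"
        using f01 by (intro integrable_const_bound[where B = 1]) auto
      show "indicator {\<omega> \<in> space M. \<not> L2_set (X n \<omega>) {..<p} \<le> C} \<omega> \<le> f (real k) (X n \<omega>)" for \<omega>
        using that f01 by (auto simp: f_def indicator_def)
    qed
    finally show ?thesis .
  qed
  show "\<forall>\<^sub>F C in at_top. \<forall>\<^sub>F n in sequentially. prob {\<omega> \<in> space M. \<not> L2_set (X n \<omega>) {..<p} \<le> C} \<le> \<epsilon>"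
    using eventually_ge_at_top[of "real k + 1"]
  proof eventually_elim
    case (elim C)
    from ev show ?case by eventually_elim (use bound[OF elim] in \<open>meson less_imp_le order_trans\<close>)
  qed
qed

section \<open>Expansion of the criteria\<close>

lemma abs_le_L2_set: "finite I \<Longrightarrow> i \<in> I \<Longrightarrow> \<bar>f i\<bar> \<le> L2_set f I"
  using member_le_L2_set[of I i "\<lambda>i. \<bar>f i\<bar>"] by (simp add: L2_set_def)

text \<open>Chosen such that an entrywise error \<open>(1 + p * C) * det_tolerance p C\<close> in a matrix with entries bounded
  by \<open>C\<close> changes its determinant by at most \<open>1 / (2 * C)\<close>.\<close>

definition det_tolerance :: "nat \<Rightarrow> real \<Rightarrow> real" where
  "det_tolerance p C = 1 / (2 * C * ((1 + p * C) * (1 + fact p * (p * (C + 1) ^ p))))"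

lemma det_tolerance:
  assumes "C \<ge> 1"
  shows "det_tolerance p C > 0" "det_tolerance p C \<le> 1" "(1 + p * C) * det_tolerance p C \<le> 1"
    "fact p * (p * (C + 1) ^ p * ((1 + p * C) * det_tolerance p C)) \<le> 1 / (2 * C)"
proof -
  \<comment> \<open>\<open>u\<close> is the growth of the entrywise error on passing from the
    optimal parameter to the QMLE, by \<open>second_derivative_bound\<close>; \<open>v\<close> is
    the Lipschitz constant of the determinant for entries bounded by \<open>C + 1\<close>.\<close>
  define u where "u = 1 + p * C"
  define v where "v = fact p * (p * (C + 1) ^ p)"
  have u: "u \<ge> 1" and v: "v \<ge> 0" using assms by (simp_all add: u_def v_def)
  have h: "det_tolerance p C = 1 / (2 * C * (u * (1 + v)))"
    by (simp add: det_tolerance_def u_def v_def)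
  show "det_tolerance p C > 0" unfolding h using assms u v by simp
  have "2 * C * (1 + v) \<ge> 1 * 1" using assms v by (intro mult_mono) auto
  moreover have "u * det_tolerance p C = 1 / (2 * C * (1 + v))" unfolding h using u by simp
  ultimately have le: "u * det_tolerance p C \<le> 1" by simp
  then show "(1 + p * C) * det_tolerance p C \<le> 1" by (simp add: u_def)
  have "1 * det_tolerance p C \<le> u * det_tolerance p C"
    using u \<open>det_tolerance p C > 0\<close> by (intro mult_right_mono) auto
  with le show "det_tolerance p C \<le> 1" by simp
  have "v * (u * det_tolerance p C) = v / (1 + v) * (1 / (2 * C))"
    unfolding h using assms u by simp
  also have "\<dots> \<le> 1 * (1 / (2 * C))"
    using assms v by (intro mult_right_mono) (auto simp: field_simps)
  finally show "fact p * (p * (C + 1) ^ p * ((1 + p * C) * det_tolerance p C)) \<le> 1 / (2 * C)"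
    by (simp add: u_def v_def mult_ac)
qed

text \<open>The scaled negative Hessian at \<open>y\<close> is entrywise close to the one at
  \<open>x\<close>, and so to \<open>\<Gamma>\<close>. Its determinant therefore stays positive and
  bounded in both directions, which bounds its logarithm.\<close>

lemma (in third_order_bound) ln_det_hessian_bound:
  assumes K1: "K \<ge> 1" and \<eta>: "\<eta> = det_tolerance p K"
    and y: "y \<in> topspace (Euclidean_space p)" "\<And>i. i < p \<Longrightarrow> \<bar>y i - x i\<bar> \<le> K * \<alpha>"
    and \<Gamma>: "\<Gamma> \<in> carrier_mat p p" "\<And>i j. \<lbrakk>i < p; j < p\<rbrakk> \<Longrightarrow> \<bar>\<Gamma> $$ (i, j)\<bar> \<le> K"
    and close: "\<And>i j. \<lbrakk>i < p; j < p\<rbrakk> \<Longrightarrow> \<bar>- \<alpha>\<^sup>2 * hessian p f x $$ (i, j) - \<Gamma> $$ (i, j)\<bar> \<le> \<eta>"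
    and det\<Gamma>: "1 / K \<le> Determinant.det \<Gamma>" "Determinant.det \<Gamma> \<le> K"
  shows "\<bar>ln (Determinant.det (- hessian p f y)) - 2 * p * ln (inverse \<alpha>)\<bar> \<le> 2 * K"
proof -
  note tol = det_tolerance[OF K1, of p, folded \<eta>]
  define B where "B = \<alpha>\<^sup>2 \<cdot>\<^sub>m (- hessian p f y)"
  have B: "B \<in> carrier_mat p p" by (simp add: B_def hessian_def)
  have diff: "\<bar>B $$ (i, j) - \<Gamma> $$ (i, j)\<bar> \<le> (1 + p * K) * \<eta>" if "i < p" "j < p" for i j
  proof -
    have "\<bar>- \<alpha>\<^sup>2 * pd i (pd j f) x - \<Gamma> $$ (i, j)\<bar> \<le> \<eta>"
      using close[OF that] that by (simp add: hessian_def)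
    moreover have "\<bar>\<alpha>\<^sup>2 * pd i (pd j f) y - \<alpha>\<^sup>2 * pd i (pd j f) x\<bar> \<le> real p * K * \<eta>"
      using y that by (rule second_derivative_bound)
    moreover have "B $$ (i, j) = - (\<alpha>\<^sup>2 * pd i (pd j f) y)"
      using that by (simp add: B_def hessian_def)
    ultimately show ?thesis unfolding distrib_right by linarith
  qed
  have "\<bar>Determinant.det B - Determinant.det \<Gamma>\<bar> \<le> fact p * (p * (K + 1) ^ p * ((1 + p * K) * \<eta>))"
  proof (rule abs_det_diff_le[OF B \<Gamma>(1)])
    show "\<bar>B $$ (i, j)\<bar> \<le> K + 1" if "i < p" "j < p" for i j
      using diff[OF that] \<Gamma>(2)[OF that] tol(3) by linarith
    show "\<bar>\<Gamma> $$ (i, j)\<bar> \<le> K + 1" if "i < p" "j < p" for i j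
      using \<Gamma>(2)[OF that] by linarith
  qed (use K1 tol(1) diff in auto)
  with tol(4) have "\<bar>Determinant.det B - Determinant.det \<Gamma>\<bar> \<le> 1 / (2 * K)" by linarith
  \<comment> \<open>The determinant moves by at most half of its lower bound \<open>1 / K\<close>,
    so the other half remains.\<close>
  moreover have "1 / K = 1 / (2 * K) + 1 / (2 * K)" "1 / (2 * K) \<le> 1" using K1 by (auto simp: field_simps)
  ultimately have lower: "1 / (2 * K) \<le> Determinant.det B" and upper: "Determinant.det B \<le> K + 1"
    using det\<Gamma> by linarith+
  have "1 / (2 * K) > 0" using K1 by simp
  with lower have pos: "Determinant.det B > 0" by linarith
  have "ln (Determinant.det B) \<le> ln (K + 1)" using pos upper by simp
  moreover have "ln (K + 1) \<le> K" using K1 ln_le_minus_one[of "K + 1"] by simp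
  moreover have "ln (1 / (2 * K)) \<le> ln (Determinant.det B)" using pos lower K1 by (subst ln_le_cancel_iff) auto
  moreover have "ln (1 / (2 * K)) \<ge> - (2 * K)" using K1 ln_le_minus_one[of "2 * K"] by (simp add: ln_div)
  ultimately have "\<bar>ln (Determinant.det B)\<bar> \<le> 2 * K" using K1 by linarith
  \<comment> \<open>The \<open>p\<close> factors \<open>\<alpha>\<^sup>2\<close> are the source of
    the penalty \<open>2 * p * ln (inverse \<alpha>)\<close>.\<close>
  moreover have detB: "Determinant.det B = (\<alpha>\<^sup>2) ^ p * Determinant.det (- hessian p f y)"
    by (simp add: B_def hessian_def)
  moreover have "Determinant.det (- hessian p f y) > 0"
    using pos \<alpha> unfolding detB by (simp add: zero_less_mult_iff)
  then have "ln (Determinant.det B) = p * (2 * ln \<alpha>) + ln (Determinant.det (- hessian p f y))"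
    using \<alpha> by (simp add: detB ln_mult ln_realpow)
  ultimately show ?thesis using \<alpha> by (simp add: ln_inverse)
qed

context prob_space
begin

text \<open>Tightness of the rescaled error in Euclidean norm, turned into coordinatewise bounds
  that fit the boxes of the derivative estimates.\<close>

lemma qmle_tightly:
  assumes "candidate_model M a A" "\<And>n. a n > 0"
  shows "tightly M (\<lambda>C n \<omega>. qmle A n \<omega> \<in> topspace (Euclidean_space (pdim A)) \<and>
    (\<forall>i<pdim A. \<bar>qmle A n \<omega> i - opt A i\<bar> \<le> C * a n))"
proof -
  obtain L where L: "prob_space L" "sets L = sets (borelE (pdim A))"
    "converges_in_distr M (pdim A) (\<lambda>n \<omega> i. (qmle A n \<omega> i - opt A i) / a n) L"
    using assms(1) unfolding candidate_model_def qmle_rate_def by blast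
  have q: "qmle A n \<in> measurable M (borelE (pdim A))" for n
    using assms(1) by (simp add: candidate_model_def valid_qmle_def)
  have [measurable]: "(\<lambda>\<omega>. qmle A n \<omega> i) \<in> borel_measurable M" for n i
  proof -
    have "(\<lambda>x. x i) \<in> borel_measurable (borelE (pdim A))"
      unfolding borelE_def by (intro measurable_restrict_space1) measurable
    from measurable_compose[OF q this] show ?thesis .
  qed
  have "tightly M (\<lambda>C n \<omega>. L2_set (\<lambda>i. (qmle A n \<omega> i - opt A i) / a n) {..<pdim A} \<le> C)"
    by (rule converges_in_distr_tightly[OF L(1,2) _ L(3)]) measurable
  then show ?thesis
  proof (rule tightly_mono, intro always_eventually allI ballI impI)
    fix C n \<omega> assume \<omega>: "\<omega> \<in> space M"
      and C: "L2_set (\<lambda>i. (qmle A n \<omega> i - opt A i) / a n) {..<pdim A} \<le> C"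
    have "qmle A n \<omega> \<in> topspace (Euclidean_space (pdim A))"
      using measurable_space[OF q \<omega>] by (simp add: borelE_def space_restrict_space)
    moreover have "\<bar>qmle A n \<omega> i - opt A i\<bar> \<le> C * a n" if "i < pdim A" for i
    proof -
      have "\<bar>(qmle A n \<omega> i - opt A i) / a n\<bar> \<le> C"
        using abs_le_L2_set[of "{..<pdim A}" i "\<lambda>i. (qmle A n \<omega> i - opt A i) / a n"] that C by simp
      then show ?thesis using assms(2)[of n] by (simp add: field_simps)
    qed
    ultimately show "qmle A n \<omega> \<in> topspace (Euclidean_space (pdim A)) \<and>
      (\<forall>i<pdim A. \<bar>qmle A n \<omega> i - opt A i\<bar> \<le> C * a n)" by blast
  qed
qed

text \<open>All random input is collected in one tight property \<open>good\<close>; once it holds,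
  the estimates are deterministic. The likelihood gain is nonnegative because the QMLE maximizes
  over a set containing the optimal parameter.\<close>

lemma model_expansion:
  assumes cand: "candidate_model M a A" and A1: "cond_A1 M a A"
    and a: "\<And>n. a n > 0" "a \<longlonglongrightarrow> 0"
  shows "tightly M (\<lambda>C n \<omega>. qlik A n \<omega> (opt A) \<le> qlik A n \<omega> (qmle A n \<omega>) \<and>
      qlik A n \<omega> (qmle A n \<omega>) - qlik A n \<omega> (opt A) \<le> C \<and>
      \<bar>ln (Determinant.det (- hessian (pdim A) (qlik A n \<omega>) (qmle A n \<omega>)))
        - 2 * pdim A * ln (inverse (a n))\<bar> \<le> C)"
proof -
  define p where "p = pdim A"
  define \<Theta> where "\<Theta> = pspace A"
  define x where "x = opt A"
  define H where "H = qlik A"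
  have open_\<Theta>: "openin (Euclidean_space p) \<Theta>" and "x \<in> \<Theta>"
    using cand by (auto simp: candidate_model_def bounded_convex_domain_def valid_limit_def p_def \<Theta>_def x_def)
  then have x_top: "x \<in> topspace (Euclidean_space p)" using openin_subset by blast
  obtain d where d: "d > 0" "\<forall>y\<in>topspace (Euclidean_space p). (\<forall>i<p. \<bar>y i - x i\<bar> < d) \<longrightarrow> y \<in> \<Theta>"
    using openin_Euclidean_space_box[OF open_\<Theta> \<open>x \<in> \<Theta>\<close>] by (elim exE conjE)
  have "x \<in> pclosure A"
    using \<open>x \<in> \<Theta>\<close> closure_of_subset[OF openin_subset[OF open_\<Theta>]]
    by (auto simp: pclosure_def p_def \<Theta>_def)
  note A1' = A1[unfolded cond_A1_def Let_def, folded p_def \<Theta>_def x_def H_def]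
  have smooth: "AE \<omega> in M. class_C p 3 \<Theta> (H n \<omega>)" for n using A1' by blast
  have grad: "big_Op1 M (\<lambda>n \<omega>. ennreal (L2_set (\<lambda>i. a n * pd i (H n \<omega>) x) {..<p}))"
    using A1' by blast
  obtain \<Gamma>0 where [measurable]: "\<And>i j. \<lbrakk>i < p; j < p\<rbrakk> \<Longrightarrow> (\<lambda>\<omega>. \<Gamma>0 \<omega> $$ (i, j)) \<in> borel_measurable M"
    and pd: "AE \<omega> in M. pos_definite p (\<Gamma>0 \<omega>)"
    and hess: "\<And>i j. \<lbrakk>i < p; j < p\<rbrakk> \<Longrightarrow> small_op1 M (\<lambda>n \<omega>.
              ennreal \<bar>- (a n)\<^sup>2 * hessian p (H n \<omega>) x $$ (i, j) - \<Gamma>0 \<omega> $$ (i, j)\<bar>)"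
    using A1' by blast
  have third: "small_op1 M (\<lambda>n \<omega>. SUP (i, j, k) \<in> {..<p} \<times> {..<p} \<times> {..<p}. SUP \<theta> \<in> \<Theta>.
        ennreal \<bar>a n ^ 3 * pd i (pd j (pd k (H n \<omega>))) \<theta>\<bar>)"
    using A1' by blast
  \<comment> \<open>The Leibniz formula is written out because \<open>\<Gamma>0 \<omega>\<close> is
    a \<open>p\<close> by \<open>p\<close> matrix only almost surely; \<open>D\<close> is measurable
    in any case and equals the determinant where \<open>\<Gamma>0 \<omega>\<close> is positive
    definite.\<close>
  define D where "D \<omega> = (\<Sum> \<sigma> | \<sigma> permutes {0..<p}. of_int (sign \<sigma>) * (\<Prod>i = 0..<p. \<Gamma>0 \<omega> $$ (i, \<sigma> i)))" for \<omega>
  have D_meas: "D \<in> borel_measurable M"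
    unfolding D_def
  proof (intro borel_measurable_sum borel_measurable_times borel_measurable_prod borel_measurable_const)
    fix \<sigma> i assume "\<sigma> \<in> {\<sigma>. \<sigma> permutes {0..<p}}" "i \<in> {0..<p}"
    then have "i < p" "\<sigma> i < p" using permutes_in_image[of \<sigma> "{0..<p}" i] by auto
    then show "(\<lambda>\<omega>. \<Gamma>0 \<omega> $$ (i, \<sigma> i)) \<in> borel_measurable M" by measurable
  qed
  have D_det: "D \<omega> = Determinant.det (\<Gamma>0 \<omega>)" if "pos_definite p (\<Gamma>0 \<omega>)" for \<omega>
    using that det_def'[of "\<Gamma>0 \<omega>" p] by (simp add: D_def pos_definite_def)
  have D_pos: "AE \<omega> in M. D \<omega> > 0"
    using pd by eventually_elim (simp add: D_det pos_definite_det_pos)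
  define good where "good C n \<omega> \<longleftrightarrow>
      (qmle A n \<omega> \<in> topspace (Euclidean_space p) \<and> (\<forall>i<p. \<bar>qmle A n \<omega> i - x i\<bar> \<le> C * a n)) \<and>
      class_C p 3 \<Theta> (H n \<omega>) \<and> pos_definite p (\<Gamma>0 \<omega>) \<and>
      is_arg_max (H n \<omega>) (\<lambda>\<theta>. \<theta> \<in> pclosure A) (qmle A n \<omega>) \<and>
      ennreal (L2_set (\<lambda>i. a n * pd i (H n \<omega>) x) {..<p}) \<le> ennreal C \<and>
      (\<forall>(i, j)\<in>{..<p} \<times> {..<p}. \<bar>\<Gamma>0 \<omega> $$ (i, j)\<bar> \<le> C) \<and>
      (\<forall>(i, j)\<in>{..<p} \<times> {..<p}. ennreal \<bar>- (a n)\<^sup>2 * hessian p (H n \<omega>) x $$ (i, j) - \<Gamma>0 \<omega> $$ (i, j)\<bar>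
         \<le> ennreal (det_tolerance p C)) \<and>
      (SUP (i, j, k) \<in> {..<p} \<times> {..<p} \<times> {..<p}. SUP \<theta> \<in> \<Theta>.
        ennreal \<bar>a n ^ 3 * pd i (pd j (pd k (H n \<omega>))) \<theta>\<bar>) \<le> ennreal (det_tolerance p C) \<and>
      \<bar>D \<omega>\<bar> \<le> C \<and> D \<omega> \<ge> 1 / C" for C n \<omega>
  have tol_pos: "\<forall>\<^sub>F C in at_top. det_tolerance p C > 0"
    using eventually_ge_at_top[of 1] by eventually_elim (rule det_tolerance)
  have "tightly M good"
    unfolding good_def
  proof (intro tightly_conj)
    show "tightly M (\<lambda>C n \<omega>. qmle A n \<omega> \<in> topspace (Euclidean_space p))"
      "tightly M (\<lambda>C n \<omega>. \<forall>i<p. \<bar>qmle A n \<omega> i - x i\<bar> \<le> C * a n)"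
      using qmle_tightly[OF cand a(1)] unfolding p_def x_def
      by (auto elim!: tightly_mono)
    show "tightly M (\<lambda>C n \<omega>. class_C p 3 \<Theta> (H n \<omega>))" using smooth by (rule tightly_always)
    show "tightly M (\<lambda>C n \<omega>. pos_definite p (\<Gamma>0 \<omega>))" using pd by (rule tightly_always)
    show "tightly M (\<lambda>C n \<omega>. is_arg_max (H n \<omega>) (\<lambda>\<theta>. \<theta> \<in> pclosure A) (qmle A n \<omega>))"
      using cand unfolding candidate_model_def valid_qmle_def H_def by (intro tightly_always) blast
    show "tightly M (\<lambda>C n \<omega>. ennreal (L2_set (\<lambda>i. a n * pd i (H n \<omega>) x) {..<p}) \<le> ennreal C)"
      using grad by (rule tightly_big_Op1)
    show "tightly M (\<lambda>C n \<omega>. \<forall>(i, j)\<in>{..<p} \<times> {..<p}. \<bar>\<Gamma>0 \<omega> $$ (i, j)\<bar> \<le> C)"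
      unfolding case_prod_beta by (intro tightly_ball tightly_random_variable) auto
    show "tightly M (\<lambda>C n \<omega>. \<forall>(i, j)\<in>{..<p} \<times> {..<p}.
        ennreal \<bar>- (a n)\<^sup>2 * hessian p (H n \<omega>) x $$ (i, j) - \<Gamma>0 \<omega> $$ (i, j)\<bar> \<le> ennreal (det_tolerance p C))"
      unfolding case_prod_beta by (intro tightly_ball tightly_small_op1 hess tol_pos) auto
    show "tightly M (\<lambda>C n \<omega>. (SUP (i, j, k) \<in> {..<p} \<times> {..<p} \<times> {..<p}. SUP \<theta> \<in> \<Theta>.
        ennreal \<bar>a n ^ 3 * pd i (pd j (pd k (H n \<omega>))) \<theta>\<bar>) \<le> ennreal (det_tolerance p C))"
      using third tol_pos by (rule tightly_small_op1)
    show "tightly M (\<lambda>C n \<omega>. \<bar>D \<omega>\<bar> \<le> C)" using D_meas by (rule tightly_random_variable)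
    show "tightly M (\<lambda>C n \<omega>. D \<omega> \<ge> 1 / C)"
      using D_meas D_pos by (rule tightly_positive_random_variable)
  qed
  \<comment> \<open>The first summand bounds the error of the log determinant. The second is the
    bound of \<open>function_bound\<close> with gradient at most \<open>C\<close>, Hessian entries
    at most \<open>C + 1 \<le> 2 * C\<close>, and third derivatives at most
    \<open>1\<close>.\<close>
  define bd where "bd C = 2 * C + real p * C * (C + real p * C * (2 * C + real p * C * 1))" for C
  let ?R = "\<lambda>C n \<omega>. H n \<omega> x \<le> H n \<omega> (qmle A n \<omega>) \<and> H n \<omega> (qmle A n \<omega>) - H n \<omega> x \<le> C \<and>
      \<bar>ln (Determinant.det (- hessian p (H n \<omega>) (qmle A n \<omega>))) - 2 * p * ln (inverse (a n))\<bar> \<le> C"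
  \<comment> \<open>The condition \<open>a n < d / C\<close> keeps the box of radius
    \<open>C * a n\<close> inside the parameter space.\<close>
  have main: "?R (bd C) n \<omega>" if C: "C \<ge> 1" and n: "a n < d / C" and good: "good C n \<omega>" for C n \<omega>
  proof -
    let ?q = "qmle A n \<omega>" and ?\<eta> = "det_tolerance p C"
    note tol = det_tolerance[OF C, of p]
    have q: "?q \<in> topspace (Euclidean_space p)" "\<And>i. i < p \<Longrightarrow> \<bar>?q i - x i\<bar> \<le> C * a n"
      using good by (auto simp: good_def)
    interpret third_order_bound p \<Theta> "H n \<omega>" x "a n" C ?\<eta>
    proof
      show "class_C p 3 \<Theta> (H n \<omega>)" using good by (simp add: good_def)
      show "x \<in> topspace (Euclidean_space p)" "a n > 0" "C \<ge> 0" using x_top a(1) C by auto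
      fix y assume y: "y \<in> topspace (Euclidean_space p)" "\<And>i. i < p \<Longrightarrow> \<bar>y i - x i\<bar> \<le> C * a n"
      have "C * a n < d" using n C by (simp add: field_simps)
      then have "\<forall>i<p. \<bar>y i - x i\<bar> < d" using y(2) by (meson le_less_trans)
      with d(2) y(1) show "y \<in> \<Theta>" by simp
    next
      have le: "(SUP (i, j, k) \<in> {..<p} \<times> {..<p} \<times> {..<p}. SUP \<theta> \<in> \<Theta>.
        ennreal \<bar>a n ^ 3 * pd i (pd j (pd k (H n \<omega>))) \<theta>\<bar>) \<le> ennreal ?\<eta>"
        using good unfolding good_def by blast
      fix i j k y assume ijk: "i < p" "j < p" "k < p" and y: "y \<in> \<Theta>"
      have "(SUP \<theta> \<in> \<Theta>. ennreal \<bar>a n ^ 3 * pd i (pd j (pd k (H n \<omega>))) \<theta>\<bar>) \<le> ennreal ?\<eta>"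
        using bspec[OF le[unfolded SUP_le_iff], of "(i, j, k)"] ijk by simp
      with y have "ennreal \<bar>a n ^ 3 * pd i (pd j (pd k (H n \<omega>))) y\<bar> \<le> ennreal ?\<eta>"
        by (simp only: SUP_le_iff)
      then show "\<bar>a n ^ 3 * pd i (pd j (pd k (H n \<omega>))) y\<bar> \<le> ?\<eta>"
        using tol(1) by (simp add: ennreal_le_iff)
    qed
    have \<Gamma>: "\<bar>\<Gamma>0 \<omega> $$ (i, j)\<bar> \<le> C"
      and close: "\<bar>- (a n)\<^sup>2 * hessian p (H n \<omega>) x $$ (i, j) - \<Gamma>0 \<omega> $$ (i, j)\<bar> \<le> ?\<eta>" if "i < p" "j < p" for i j
      using good that tol(1) unfolding good_def by (auto simp: ennreal_le_iff)
    have pos: "pos_definite p (\<Gamma>0 \<omega>)" and D: "\<bar>D \<omega>\<bar> \<le> C" "1 / C \<le> D \<omega>"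
      using good by (auto simp: good_def)
    have "\<bar>ln (Determinant.det (- hessian p (H n \<omega>) ?q)) - 2 * p * ln (inverse (a n))\<bar> \<le> 2 * C"
      using pos D \<Gamma> close
      by (intro ln_det_hessian_bound[OF C refl q, of "\<Gamma>0 \<omega>"]) (auto simp: pos_definite_def D_det[OF pos])
    moreover have "\<bar>H n \<omega> ?q - H n \<omega> x\<bar> \<le> real p * C * (C + real p * C * (2 * C + real p * C * ?\<eta>))"
    proof (rule function_bound[OF q])
      have "L2_set (\<lambda>i. a n * pd i (H n \<omega>) x) {..<p} \<le> C"
        using good C by (simp add: good_def ennreal_le_iff)
      then show "\<bar>a n * pd k (H n \<omega>) x\<bar> \<le> C" if "k < p" for k
        using abs_le_L2_set[of "{..<p}" k "\<lambda>i. a n * pd i (H n \<omega>) x"] that by simp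
      show "\<bar>(a n)\<^sup>2 * pd j (pd k (H n \<omega>)) x\<bar> \<le> 2 * C" if "j < p" "k < p" for j k
        using \<Gamma>[OF that] close[OF that] tol(2) C that by (simp add: hessian_def)
    qed
    moreover have "\<dots> \<le> real p * C * (C + real p * C * (2 * C + real p * C * 1))"
      using C tol(2) by (intro mult_left_mono add_left_mono) auto
    moreover have "0 \<le> real p * C * (C + real p * C * (2 * C + real p * C * 1))"
      using C by simp
    moreover have "H n \<omega> x \<le> H n \<omega> ?q"
      using good \<open>x \<in> pclosure A\<close> by (auto simp: good_def is_arg_max_linorder)
    ultimately show ?thesis using C unfolding bd_def by linarith
  qed
  have "tightly M (\<lambda>C. ?R (bd C))"
    using \<open>tightly M good\<close>
  proof (rule tightly_mono)
    show "\<forall>\<^sub>F C in at_top. \<forall>\<^sub>F n in sequentially. \<forall>\<omega>\<in>space M. good C n \<omega> \<longrightarrow> ?R (bd C) n \<omega>"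
      using eventually_ge_at_top[of 1]
    proof eventually_elim
      case (elim C)
      then have "d / C > 0" using d(1) by simp
      then have "\<forall>\<^sub>F n in sequentially. a n < d / C" by (rule order_tendstoD(2)[OF a(2)])
      then show ?case by eventually_elim (use main[OF elim] in blast)
    qed
  qed
  then have "tightly M ?R" by (rule tightly_reparam) auto
  then show ?thesis by (simp only: p_def x_def H_def)
qed

lemma criterion_expansion:
  assumes "candidate_model M a A" "cond_A1 M a A" and "\<And>n. a n > 0" "a \<longlonglongrightarrow> 0"
  shows "tightly M (\<lambda>C n \<omega>. \<bar>QBIC A n \<omega> + 2 * qlik A n \<omega> (opt A) - 2 * pdim A * ln (inverse (a n))\<bar> \<le> C)"
    and "tightly M (\<lambda>C n \<omega>. \<bar>BIC a A n \<omega> + 2 * qlik A n \<omega> (opt A) - 2 * pdim A * ln (inverse (a n))\<bar> \<le> C)"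
proof -
  \<comment> \<open>In \<open>3 * C\<close>, twice the likelihood gain accounts for
    \<open>2 * C\<close> and the log determinant for \<open>C\<close>.\<close>
  have *: "tightly M Q"
    if "\<And>C n \<omega>. \<lbrakk>qlik A n \<omega> (opt A) \<le> qlik A n \<omega> (qmle A n \<omega>);
        qlik A n \<omega> (qmle A n \<omega>) - qlik A n \<omega> (opt A) \<le> C;
        \<bar>ln (Determinant.det (- hessian (pdim A) (qlik A n \<omega>) (qmle A n \<omega>)))
          - 2 * pdim A * ln (inverse (a n))\<bar> \<le> C\<rbrakk> \<Longrightarrow> Q (3 * C) n \<omega>"
      and "\<And>C C' n \<omega>. \<lbrakk>C \<le> C'; \<omega> \<in> space M; Q C n \<omega>\<rbrakk> \<Longrightarrow> Q C' n \<omega>" for Q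
  proof (rule tightly_reparam)
    show "tightly M (\<lambda>C. Q (3 * C))"
      using model_expansion[OF assms]
      by (rule tightly_mono) (intro always_eventually allI ballI impI that(1), auto)
  qed (fact that(2))
  show "tightly M (\<lambda>C n \<omega>. \<bar>QBIC A n \<omega> + 2 * qlik A n \<omega> (opt A) - 2 * pdim A * ln (inverse (a n))\<bar> \<le> C)"
    by (rule *) (simp_all add: QBIC_def)
  show "tightly M (\<lambda>C n \<omega>. \<bar>BIC a A n \<omega> + 2 * qlik A n \<omega> (opt A) - 2 * pdim A * ln (inverse (a n))\<bar> \<le> C)"
    by (rule *) (simp_all add: BIC_def)
qed

section \<open>Comparison of two expanded criteria\<close>

lemma criterion_prefers_smaller:
  fixes p q :: nat and H I J :: "nat \<Rightarrow> 'a \<Rightarrow> real"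
  assumes I: "tightly M (\<lambda>C n \<omega>. \<bar>I n \<omega> + 2 * H n \<omega> - 2 * p * ln (inverse (a n))\<bar> \<le> C)"
    and J: "tightly M (\<lambda>C n \<omega>. \<bar>J n \<omega> + 2 * H' n \<omega> - 2 * q * ln (inverse (a n))\<bar> \<le> C)"
    and a: "\<And>n. a n > 0" "a \<longlonglongrightarrow> 0"
    and "p < q" and eq: "\<And>n. AE \<omega> in M. H n \<omega> = H' n \<omega>"
  shows "tightly M (\<lambda>C n \<omega>. I n \<omega> - J n \<omega> < 0)"
proof (rule tightly_mono[OF tightly_conj[OF I tightly_conj[OF J
        tightly_always[where Q = "\<lambda>n \<omega>. H n \<omega> = H' n \<omega>", OF eq]]]], rule always_eventually, rule allI)
  fix C :: real
  \<comment> \<open>The likelihoods cancel and the dimensions differ by at least 1, so the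
    difference of the criteria is at most \<open>2 * C - 2 * ln (inverse (a n))\<close>; this
    threshold makes it negative.\<close>
  have "\<forall>\<^sub>F n in sequentially. a n < exp (- \<bar>C\<bar> - 1)" by (rule order_tendstoD(2)[OF a(2)]) simp
  then show "\<forall>\<^sub>F n in sequentially. \<forall>\<omega>\<in>space M.
      \<bar>I n \<omega> + 2 * H n \<omega> - 2 * p * ln (inverse (a n))\<bar> \<le> C \<and>
      \<bar>J n \<omega> + 2 * H' n \<omega> - 2 * q * ln (inverse (a n))\<bar> \<le> C \<and> H n \<omega> = H' n \<omega> \<longrightarrow> I n \<omega> - J n \<omega> < 0"
  proof eventually_elim
    case (elim n)
    let ?l = "ln (inverse (a n))"
    have "ln (a n) < - \<bar>C\<bar> - 1" using elim a(1)[of n] by (metis exp_gt_zero ln_exp ln_less_cancel_iff)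
    then have l: "?l > \<bar>C\<bar> + 1" using a(1)[of n] by (simp add: ln_inverse)
    have "real p + 1 \<le> real q" using \<open>p < q\<close> by simp
    then have "(real p + 1) * ?l \<le> real q * ?l" using l by (intro mult_right_mono) auto
    then have "2 * p * ?l + 2 * ?l \<le> 2 * q * ?l" by (simp add: algebra_simps)
    with l show ?case by (intro ballI impI) linarith
  qed
qed

lemma criterion_prefers_better:
  fixes p q :: nat and H I J :: "nat \<Rightarrow> 'a \<Rightarrow> real"
  assumes I: "tightly M (\<lambda>C n \<omega>. \<bar>I n \<omega> + 2 * H n \<omega> - 2 * p * ln (inverse (a n))\<bar> \<le> C)"
    and J: "tightly M (\<lambda>C n \<omega>. \<bar>J n \<omega> + 2 * H' n \<omega> - 2 * q * ln (inverse (a n))\<bar> \<le> C)"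
    and a: "\<And>n. a n > 0" "a \<longlonglongrightarrow> 0"
    and H: "small_op1 M (\<lambda>n \<omega>. ennreal \<bar>(a n)\<^sup>2 * H n \<omega> - L \<omega>\<bar>)" "L \<in> borel_measurable M"
    and H': "small_op1 M (\<lambda>n \<omega>. ennreal \<bar>(a n)\<^sup>2 * H' n \<omega> - L' \<omega>\<bar>)" "L' \<in> borel_measurable M"
    and less: "AE \<omega> in M. L' \<omega> < L \<omega>"
  shows "tightly M (\<lambda>C n \<omega>. I n \<omega> - J n \<omega> < 0)"
proof -
  \<comment> \<open>Two errors of \<open>1 / (4 * C)\<close> leave half of a gap
    \<open>1 / C\<close> between the scaled likelihoods; the factor 2 in the criteria restores
    \<open>1 / C\<close>.\<close>
  have pos: "\<forall>\<^sub>F C in at_top. 1 / (4 * C) > (0 :: real)"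
    using eventually_gt_at_top[of 0] by eventually_elim simp
  have gap: "tightly M (\<lambda>C n \<omega>. L \<omega> - L' \<omega> \<ge> 1 / C)"
    using H(2) H'(2) less by (intro tightly_positive_random_variable) auto
  note * = tightly_conj[OF I tightly_conj[OF J tightly_conj[OF gap
    tightly_conj[OF tightly_small_op1[OF H(1) pos] tightly_small_op1[OF H'(1) pos]]]]]
  show ?thesis
  proof (rule tightly_mono[OF *], rule eventually_mono[OF eventually_gt_at_top[of 0]])
    fix C :: real assume "C > 0"
    \<comment> \<open>After multiplication by \<open>(a n)\<^sup>2\<close> the bounded errors
      contribute \<open>2 * C * (a n)\<^sup>2\<close>, and the penalty of the better model at most
      \<open>2 * p * a n\<close>, since \<open>ln t \<le> t - 1\<close> at
      \<open>t = inverse (a n)\<close>.\<close>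
    have "(\<lambda>n. 2 * C * (a n)\<^sup>2 + 2 * p * a n) \<longlonglongrightarrow> 2 * C * 0\<^sup>2 + real (2 * p) * 0"
      by (intro tendsto_intros a)
    moreover have "2 * C * 0\<^sup>2 + real (2 * p) * 0 < 1 / C" using \<open>C > 0\<close> by simp
    ultimately have "\<forall>\<^sub>F n in sequentially. 2 * C * (a n)\<^sup>2 + 2 * p * a n < 1 / C"
      by (rule order_tendstoD(2))
    moreover have "\<forall>\<^sub>F n in sequentially. a n < 1" using a(2) by (rule order_tendstoD(2)) simp
    ultimately show "\<forall>\<^sub>F n in sequentially. \<forall>\<omega>\<in>space M.
      \<bar>I n \<omega> + 2 * H n \<omega> - 2 * p * ln (inverse (a n))\<bar> \<le> C \<and>
      \<bar>J n \<omega> + 2 * H' n \<omega> - 2 * q * ln (inverse (a n))\<bar> \<le> C \<and>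
      1 / C \<le> L \<omega> - L' \<omega> \<and>
      ennreal \<bar>(a n)\<^sup>2 * H n \<omega> - L \<omega>\<bar> \<le> ennreal (1 / (4 * C)) \<and>
      ennreal \<bar>(a n)\<^sup>2 * H' n \<omega> - L' \<omega>\<bar> \<le> ennreal (1 / (4 * C)) \<longrightarrow> I n \<omega> - J n \<omega> < 0"
    proof eventually_elim
      case (elim n)
      let ?l = "ln (inverse (a n))"
      have an: "a n > 0" by (rule a)
      have l: "0 \<le> ?l" using elim(2) an by (simp add: one_le_inverse)
      have "a n * ?l \<le> a n * inverse (a n)"
        using an ln_le_minus_one[of "inverse (a n)"] by (intro mult_left_mono) auto
      then have "a n * (a n * ?l) \<le> a n * 1" using an by (intro mult_left_mono) auto
      then have "2 * p * (a n * (a n * ?l)) \<le> 2 * p * a n" by (intro mult_left_mono) auto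
      then have l2: "(a n)\<^sup>2 * (2 * p * ?l) \<le> 2 * p * a n" by (simp add: power2_eq_square mult_ac)
      show ?case
      proof (intro ballI impI)
        fix \<omega>
        assume *: "\<bar>I n \<omega> + 2 * H n \<omega> - 2 * p * ?l\<bar> \<le> C \<and>
          \<bar>J n \<omega> + 2 * H' n \<omega> - 2 * q * ?l\<bar> \<le> C \<and>
          1 / C \<le> L \<omega> - L' \<omega> \<and>
          ennreal \<bar>(a n)\<^sup>2 * H n \<omega> - L \<omega>\<bar> \<le> ennreal (1 / (4 * C)) \<and>
          ennreal \<bar>(a n)\<^sup>2 * H' n \<omega> - L' \<omega>\<bar> \<le> ennreal (1 / (4 * C))"
        have near: "\<bar>(a n)\<^sup>2 * H n \<omega> - L \<omega>\<bar> \<le> 1 / (4 * C)" "\<bar>(a n)\<^sup>2 * H' n \<omega> - L' \<omega>\<bar> \<le> 1 / (4 * C)"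
          using * \<open>C > 0\<close> by (auto simp: ennreal_le_iff)
        have "1 / C = 4 * (1 / (4 * C))" using \<open>C > 0\<close> by simp
        with near * have gap: "2 * ((a n)\<^sup>2 * H n \<omega>) - 2 * ((a n)\<^sup>2 * H' n \<omega>) \<ge> 1 / C"
          by linarith
        have "2 * q * ?l \<ge> 0" using l by simp
        then have "I n \<omega> - J n \<omega> \<le> 2 * C + 2 * p * ?l - 2 * H n \<omega> + 2 * H' n \<omega>"
          using * by linarith
        then have "(a n)\<^sup>2 * (I n \<omega> - J n \<omega>) \<le> (a n)\<^sup>2 * (2 * C + 2 * p * ?l - 2 * H n \<omega> + 2 * H' n \<omega>)"
          by (intro mult_left_mono) auto
        also have "\<dots> = 2 * C * (a n)\<^sup>2 + (a n)\<^sup>2 * (2 * p * ?l)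
            - (2 * ((a n)\<^sup>2 * H n \<omega>) - 2 * ((a n)\<^sup>2 * H' n \<omega>))"
          by (simp add: algebra_simps)
        also have "\<dots> < 0" using gap l2 elim(1) by linarith
        finally show "I n \<omega> - J n \<omega> < 0" using an by (simp add: mult_less_0_iff)
      qed
    qed
  qed
qed

text \<open>A minimizer of the dimension within the set of best models belongs to that set.\<close>

lemma optimal_model_qlim_le:
  assumes "optimal_model M N \<M> m0" "k \<in> {1..N}"
  shows "AE \<omega> in M. qlim (\<M> k) \<omega> (opt (\<M> k)) \<le> qlim (\<M> m0) \<omega> (opt (\<M> m0))"
  using assms(1) unfolding optimal_model_def Let_def
proof eventually_elim
  case (elim \<omega>)
  then have "is_arg_max (\<lambda>k. qlim (\<M> k) \<omega> (opt (\<M> k))) (\<lambda>k. k \<in> {1..N}) m0"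
    unfolding is_arg_min_def by blast
  with assms(2) show ?case by (auto simp: is_arg_max_linorder)
qed

text \<open>The embedded point \<open>y\<close> carries the limit value of the smaller model, which
  is at least the maximum of the limit in the larger one. So \<open>y\<close> is also a maximizer
  there, and uniqueness identifies it with \<open>opt B\<close>.\<close>

lemma nested_opt:
  assumes "nested M A B" "valid_limit M a A" "valid_limit M a B"
    and best: "AE \<omega> in M. qlim B \<omega> (opt B) \<le> qlim A \<omega> (opt A)"
  shows "AE \<omega> in M. qlik A n \<omega> (opt A) = qlik B n \<omega> (opt B)"
proof -
  obtain F c where F: "\<forall>\<theta> \<in> pspace A. affine_emb F c \<theta> \<in> pspace B"
    "\<forall>n. AE \<omega> in M. \<forall>\<theta> \<in> pspace A. qlik A n \<omega> \<theta> = qlik B n \<omega> (affine_emb F c \<theta>)"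
    using assms(1) unfolding nested_def by blast
  define y where "y = affine_emb F c (opt A)"
  have opt: "opt A \<in> pspace A" using assms(2) by (simp add: valid_limit_def)
  then have y: "y \<in> pspace B" using F(1) by (simp add: y_def)
  have qlik_eq: "AE \<omega> in M. qlik A n \<omega> (opt A) = qlik B n \<omega> y" for n
    using F(2)[rule_format, of n] by eventually_elim (use opt in \<open>simp add: y_def\<close>)
  have "AE \<omega> in M. qlim A \<omega> (opt A) = qlim B \<omega> y"
  proof (rule small_op1_limit_unique)
    show "small_op1 M (\<lambda>n \<omega>. ennreal \<bar>(a n)\<^sup>2 * qlik A n \<omega> (opt A) - qlim A \<omega> (opt A)\<bar>)"
      "small_op1 M (\<lambda>n \<omega>. ennreal \<bar>(a n)\<^sup>2 * qlik B n \<omega> y - qlim B \<omega> y\<bar>)"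
      using assms(2,3) opt y by (simp_all add: valid_limit_def)
    show "AE \<omega> in M. (a n)\<^sup>2 * qlik A n \<omega> (opt A) = (a n)\<^sup>2 * qlik B n \<omega> y" for n
      using qlik_eq[of n] by eventually_elim simp
  qed
  moreover have "AE \<omega> in M. {\<theta>. is_arg_max (qlim B \<omega>) (\<lambda>\<theta>. \<theta> \<in> pspace B) \<theta>} = {opt B}"
    using assms(3) by (simp add: valid_limit_def)
  ultimately have "AE \<omega> in M. y = opt B"
    using best
  proof eventually_elim
    case (elim \<omega>)
    then have "is_arg_max (qlim B \<omega>) (\<lambda>\<theta>. \<theta> \<in> pspace B) (opt B)" by blast
    then have "is_arg_max (qlim B \<omega>) (\<lambda>\<theta>. \<theta> \<in> pspace B) y"
      using elim(1,3) y by (force simp: is_arg_max_linorder)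
    with elim(2) show ?case by blast
  qed
  \<comment> \<open>Neither side depends on \<open>\<omega>\<close>, so on a probability space
    almost sure equality is equality.\<close>
  then have "y = opt B" by simp
  with qlik_eq show ?thesis by simp
qed

end

theorem theorem5p1:
  fixes P :: "'w measure" and a :: "nat \<Rightarrow> real"
    and M m0 m :: nat and \<M> :: "nat \<Rightarrow> 'w model"
  assumes "prob_space P"
    and "\<forall>n. a n > 0" and "a \<longlonglongrightarrow> 0"
    and "\<forall>k\<in>{1..M}. candidate_model P a (\<M> k)"
    and "\<forall>k\<in>{1..M}. cond_A1 P a (\<M> k) \<and> cond_A2 a (\<M> k) \<and> cond_A3 P a (\<M> k)"
    and "m0 \<in> {1..M}" and "optimal_model P M \<M> m0"
    and "m \<in> {1..M} - {m0}"
    and "nested P (\<M> m0) (\<M> m) \<or>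
         (\<forall>\<theta> \<in> pspace (\<M> m). AE \<omega> in P.
            qlim (\<M> m) \<omega> \<theta> \<noteq> qlim (\<M> m0) \<omega> (opt (\<M> m0)))"
  shows "(\<lambda>n. inner_prob P {\<omega> \<in> space P. QBIC (\<M> m0) n \<omega> - QBIC (\<M> m) n \<omega> < 0}) \<longlonglongrightarrow> 1
       \<and> (\<lambda>n. inner_prob P {\<omega> \<in> space P. BIC a (\<M> m0) n \<omega> - BIC a (\<M> m) n \<omega> < 0}) \<longlonglongrightarrow> 1"
proof -
  interpret prob_space P by fact
  let ?A = "\<M> m0" and ?B = "\<M> m"
  have a: "\<And>n. a n > 0" "a \<longlonglongrightarrow> 0" using assms(2,3) by auto
  have m: "m \<in> {1..M}" using assms(8) by blast
  have cand: "candidate_model P a ?A" "candidate_model P a ?B" "cond_A1 P a ?A" "cond_A1 P a ?B"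
    using assms(4,5,6) m by auto
  then have lim: "valid_limit P a ?A" "valid_limit P a ?B" by (auto simp: candidate_model_def)
  have le: "AE \<omega> in P. qlim ?B \<omega> (opt ?B) \<le> qlim ?A \<omega> (opt ?A)"
    using assms(7) m by (rule optimal_model_qlim_le)
  \<comment> \<open>Stated for arbitrary \<open>I\<close> and \<open>J\<close> with the common
    expansion, so that QBIC and BIC are settled by one argument.\<close>
  have comparison: "tightly P (\<lambda>C n \<omega>. I n \<omega> - J n \<omega> < 0)"
    if IJ: "tightly P (\<lambda>C n \<omega>. \<bar>I n \<omega> + 2 * qlik ?A n \<omega> (opt ?A) - 2 * pdim ?A * ln (inverse (a n))\<bar> \<le> C)"
      "tightly P (\<lambda>C n \<omega>. \<bar>J n \<omega> + 2 * qlik ?B n \<omega> (opt ?B) - 2 * pdim ?B * ln (inverse (a n))\<bar> \<le> C)"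
    for I J
    using assms(9)
  proof
    assume nested: "nested P ?A ?B"
    then have "pdim ?A < pdim ?B" by (simp add: nested_def)
    then show ?thesis
      using IJ a nested_opt[OF nested lim le] by (intro criterion_prefers_smaller)
  next
    assume "\<forall>\<theta> \<in> pspace ?B. AE \<omega> in P. qlim ?B \<omega> \<theta> \<noteq> qlim ?A \<omega> (opt ?A)"
    moreover have opt: "opt ?A \<in> pspace ?A" "opt ?B \<in> pspace ?B"
      using lim by (auto simp: valid_limit_def)
    \<comment> \<open>Taking the optimal parameter of the other model for \<open>\<theta>\<close>
      makes the inequality between the limits strict.\<close>
    ultimately have "AE \<omega> in P. qlim ?B \<omega> (opt ?B) \<noteq> qlim ?A \<omega> (opt ?A)" by blast
    with le have "AE \<omega> in P. qlim ?B \<omega> (opt ?B) < qlim ?A \<omega> (opt ?A)" by eventually_elim simp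
    then show ?thesis
      using IJ a lim opt by (intro criterion_prefers_better[OF IJ]) (auto simp: valid_limit_def)
  qed
  show ?thesis
    using cand a by (intro conjI inner_prob_tendsto_1 comparison criterion_expansion)
qed

end
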